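(* Let $n$ be a positive integer and let $R$ be a simply connected region. Then for any two order-$n$ ribbon tilings $\alpha$ and $\beta$ of $R$ there is a finite sequence of order-$n$ ribbon tilings $\alpha=\alpha_0,\alpha_1,\dots,\alpha_m=\beta$ of $R$ such that $\alpha_{r}$ and $\alpha_{r+1}$ differ by a local replacement move for each $0\le r<m$.
   Context: Squares of the grid $\mathbb Z^2$ are indexed by integer pairs; $s_{x,y}$ is the unit square at position $(x,y)$. Two squares are adjacent if they share an edge. Fix $n$; the square $s_{x,y}$ has color $c\in\mathbb Z/n\mathbb Z$ if $x+y\equiv c \pmod n$. A ribbon tile of order $n$ is a connected (via adjacency) set of squares containing exactly one square of each of the $n$ colors; equivalently, a sequence of $n$ squares each of which lies directly above or directly to the right of its predecessor. A region $R$ is a finite set of squares that is connected via adjacency. $R$ is simply connected if for every square $s\notin R$ there is no connected cycle of squares in $R$ (cyclic sequence of squares of $R$, consecutive ones adjacent) that encircles $s$ with non-zero winding number. An order-$n$ ribbon tiling of $R$ is a partition of $R$ into ribbon tiles of order $n$. Two order-$n$ ribbon tilings of $R$ differ by a local replacement move if one is obtained from the other by removing a single pair of tiles and adding another (different) pair of ribbon tiles in its place (covering the same squares). *)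

theory Defs
  imports
    "HOL-Library.Disjoint_Sets"
    "HOL-Number_Theory.Cong"
    "HOL-Complex_Analysis.Winding_Numbers"
begin

type_synonym square = "int \<times> int"

definition adjacent :: "square \<Rightarrow> square \<Rightarrow> bool" where
  "adjacent s t \<longleftrightarrow> \<bar>fst s - fst t\<bar> + \<bar>snd s - snd t\<bar> = 1"

text \<open>Connectedness of a set of squares via adjacency within the set; the empty set qualifies.\<close>
definition sq_connected :: "square set \<Rightarrow> bool" where
  "sq_connected S \<longleftrightarrow>
     (\<forall>s\<in>S. \<forall>t\<in>S. (s, t) \<in> {(u, v). u \<in> S \<and> v \<in> S \<and> adjacent u v}\<^sup>*)"

definition region :: "square set \<Rightarrow> bool" where
  "region R \<longleftrightarrow> finite R \<and> sq_connected R"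

definition has_color :: "nat \<Rightarrow> square \<Rightarrow> int \<Rightarrow> bool" where
  "has_color n s c \<longleftrightarrow> [fst s + snd s = c] (mod int n)"

text \<open>The colors in \<open>\<int>/n\<int>\<close> are represented by the residues \<open>0, \<dots>, n - 1\<close>.\<close>
definition ribbon_tile :: "nat \<Rightarrow> square set \<Rightarrow> bool" where
  "ribbon_tile n T \<longleftrightarrow> sq_connected T \<and> (\<forall>c\<in>{0..<int n}. \<exists>!s. s \<in> T \<and> has_color n s c)"

text \<open>A cyclic sequence is a nonempty list whose last entry is followed by its first one;
  squares may be visited repeatedly.\<close>
definition sq_cycle :: "square set \<Rightarrow> square list \<Rightarrow> bool" where
  "sq_cycle R c \<longleftrightarrow> c \<noteq> [] \<and> set c \<subseteq> R \<and>
     (\<forall>i<length c. adjacent (c ! i) (c ! (Suc i mod length c)))"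

text \<open>Winding numbers are those of the closed polygon through the centers of the squares of the
  cycle, about the center of the encircled square. The plane is coordinatized so that
  \<open>s\<^bsub>x,y\<^esub>\<close> has center \<open>(x, y)\<close>.\<close>
definition center :: "square \<Rightarrow> complex" where
  "center s = Complex (of_int (fst s)) (of_int (snd s))"

fun poly_path :: "complex list \<Rightarrow> real \<Rightarrow> complex" where
  "poly_path [] = linepath 0 0"
| "poly_path [a] = linepath a a"
| "poly_path [a, b] = linepath a b"
| "poly_path (a # b # c # zs) = linepath a b +++ poly_path (b # c # zs)"

definition encircles :: "square list \<Rightarrow> square \<Rightarrow> bool" where
  "encircles c s \<longleftrightarrow> winding_number (poly_path (map center (c @ [hd c]))) (center s) \<noteq> 0"

definition simply_connected_region :: "square set \<Rightarrow> bool" where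
  "simply_connected_region R \<longleftrightarrow> region R \<and> (\<forall>s. s \<notin> R \<longrightarrow> \<not> (\<exists>c. sq_cycle R c \<and> encircles c s))"

definition ribbon_tiling :: "nat \<Rightarrow> square set \<Rightarrow> square set set \<Rightarrow> bool" where
  "ribbon_tiling n R \<alpha> \<longleftrightarrow> partition_on R \<alpha> \<and> (\<forall>T\<in>\<alpha>. ribbon_tile n T)"

definition local_move :: "nat \<Rightarrow> square set set \<Rightarrow> square set set \<Rightarrow> bool" where
  "local_move n \<alpha> \<beta> \<longleftrightarrow>
     (\<exists>S T S' T'. S \<in> \<alpha> \<and> T \<in> \<alpha> \<and> S \<noteq> T \<and>
        ribbon_tile n S' \<and> ribbon_tile n T' \<and> S' \<noteq> T' \<and>
        {S', T'} \<noteq> {S, T} \<and> S' \<union> T' = S \<union> T \<and>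
        \<beta> = (\<alpha> - {S, T}) \<union> {S', T'})"

end

theory Submission
  imports Defs
begin

text \<open>Every tile has one square on each of \<open>n\<close> consecutive levels \<open>x + y\<close>, and counting the squares
  of each level shows that the number of tiles starting on a level depends only on the region.
  So the tiles of any two tilings can be identified, the \<open>j\<close>-th tile from the left among those
  starting on level \<open>l\<close> with its counterpart, and a tiling amounts to the left-to-right order of its
  tiles on each level.

  Let \<open>g\<close> be a square outside the region. A closed walk in the region has winding number 0 about
  \<open>g\<close>, which means that it crosses the half-diagonal to the left of \<open>g\<close> equally often in both
  directions. Hence there is a potential on the region that jumps by 1 across this half-diagonal
  and is constant otherwise; summing it over color classes shows that the number of tiles starting
  on a given level that pass to the left of \<open>g\<close> is the same for all tilings. So each tile passes
  \<open>g\<close> on the same side in all tilings. It also follows that two tiles whose levels are adjacent but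
  disjoint have the same order in all tilings.

  Two tilings therefore differ only in the order of pairs of tiles with overlapping levels. Take such
  an inversion that is minimal, i.e. with no tile in between in the first tiling. Then no square
  at all lies between the two tiles, and exchanging their parts on the common levels is a local
  move that removes this inversion and creates no other.\<close>

section \<open>Winding numbers of lattice walks\<close>

definition level :: "square \<Rightarrow> int" where
  "level s = fst s + snd s"

text \<open>A step counts when it goes from the level below \<open>g\<close> to the level of \<open>g\<close>, left of \<open>g\<close>. Under
  \<open>angle\<close>, multiplication by \<open>1 + \<i>\<close> turns this half-diagonal into the branch cut of \<open>Arg\<close>, which
  belongs to its upper side; hence these steps are exactly the jumps of the angle.\<close>
definition up_left :: "square \<Rightarrow> square \<Rightarrow> square \<Rightarrow> bool" where
  "up_left g a b \<longleftrightarrow> level b = level a + 1 \<and> level b = level g \<and> fst b < fst g"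

definition crossing :: "square \<Rightarrow> square \<Rightarrow> square \<Rightarrow> int" where
  "crossing g a b = of_bool (up_left g a b) - of_bool (up_left g b a)"

fun crossings :: "square \<Rightarrow> square list \<Rightarrow> int" where
  "crossings g (a # b # p) = crossing g a b + crossings g (b # p)"
| "crossings g _ = 0"

definition angle :: "square \<Rightarrow> square \<Rightarrow> real" where
  "angle g s = Arg ((center s - center g) * Complex 1 1)"

text \<open>The exponential of the winding number gives the quotient, hence its argument up to
  multiples of 2 pi. For a segment the real part is less than 1/2 in absolute value, which leaves
  only the principal value.\<close>

lemma Re_winding_number_linepath:
  assumes "z \<notin> closed_segment a b"
  shows "2 * pi * Re (winding_number (linepath a b) z) = Arg ((b - z) / (a - z))"
proof -
  let ?w = "winding_number (linepath a b) z"
  have "a \<noteq> z" using assms by auto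
  moreover have "b - z = exp (2 * pi * \<i> * ?w) * (a - z)"
    using winding_number_exp_2pi[of "linepath a b" z] assms by simp
  ultimately have "(b - z) / (a - z) = exp (2 * pi * \<i> * ?w)"
    by (simp add: field_simps)
  moreover have "\<bar>2 * pi * Re ?w\<bar> < pi"
    using mult_strict_left_mono[OF winding_number_lt_half_linepath[OF assms], of "2 * pi"]
    by (simp add: abs_mult)
  ultimately show ?thesis
    using Arg_exp[of "2 * pi * \<i> * ?w"] by (simp add: abs_less_iff)
qed

lemma Arg_divide_shift:
  assumes "u \<noteq> 0" "v \<noteq> 0" "- pi < Arg v - Arg u - 2 * pi * of_int k"
    "Arg v - Arg u - 2 * pi * of_int k \<le> pi"
  shows "Arg (v / u) = Arg v - Arg u - 2 * pi * of_int k"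
proof (rule Arg_unique')
  show "cmod v / cmod u > 0" using assms by simp
  show "Arg v - Arg u - 2 * pi * of_int k \<in> {- pi<..pi}" using assms by simp
  have "v / u = rcis (cmod v) (Arg v) / rcis (cmod u) (Arg u)"
    by (simp add: rcis_cmod_Arg)
  also have "\<dots> = rcis (cmod v / cmod u) (Arg v - Arg u)"
    by (simp add: rcis_divide)
  also have "\<dots> = rcis (cmod v / cmod u) (Arg v - Arg u - 2 * pi * of_int k)"
    by (simp add: rcis_def cis_multiple_2pi[of "of_int k"] flip: cis_divide)
  finally show "v / u = rcis (cmod v / cmod u) (Arg v - Arg u - 2 * pi * of_int k)" .
qed

lemma adjacent_sym: "adjacent a b \<longleftrightarrow> adjacent b a"
  by (auto simp: adjacent_def)

lemma adjacent_iff_level: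
  "adjacent a b \<longleftrightarrow> level b = level a + 1 \<and> (fst b = fst a \<or> fst b = fst a + 1)
    \<or> level a = level b + 1 \<and> (fst a = fst b \<or> fst a = fst b + 1)"
  by (auto simp: adjacent_def level_def)

lemmas adjacent_level = iffD1[OF adjacent_iff_level]

text \<open>One coordinate changes by exactly 1 along an edge, so a lattice point on it has an
  integer parameter, 0 or 1.\<close>

lemma center_notin_edge:
  assumes "adjacent a b" "g \<noteq> a" "g \<noteq> b"
  shows "center g \<notin> closed_segment (center a) (center b)"
proof
  assume "center g \<in> closed_segment (center a) (center b)"
  then obtain u where u: "0 \<le> u" "u \<le> 1"
    and c: "center g = (1 - u) *\<^sub>R center a + u *\<^sub>R center b"
    by (auto simp: closed_segment_def)
  have x: "of_int (fst g) = of_int (fst a) + u * of_int (fst b - fst a)"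
    and y: "of_int (snd g) = of_int (snd a) + u * of_int (snd b - snd a)"
    using c by (auto simp: center_def complex_eq_iff algebra_simps)
  obtain d :: int where "u = of_int d \<or> u = - of_int d"
  proof -
    have "fst b - fst a = 1 \<or> fst b - fst a = -1 \<or> snd b - snd a = 1 \<or> snd b - snd a = -1"
      using assms(1) by (auto simp: adjacent_def)
    then have "u = of_int (fst g - fst a) \<or> u = - of_int (fst g - fst a)
        \<or> u = of_int (snd g - snd a) \<or> u = - of_int (snd g - snd a)"
      by (elim disjE) (use x y in simp_all)
    with that show ?thesis by blast
  qed
  then obtain d :: int where d: "u = of_int d"
    by (metis of_int_minus)
  have "d = 0 \<or> d = 1" using u d by auto
  then have "g = a \<or> g = b"
    using x y d by (auto simp: prod_eq_iff)
  with assms show False by auto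
qed

text \<open>After multiplication by 1 + i the imaginary part is the level relative to
  \<open>g\<close>. The angle can jump only on arrival at the level of \<open>g\<close>: left of
  \<open>g\<close> the new angle is pi while the old one is negative, and the crossing corrects
  exactly this.\<close>

lemma Arg_up_step:
  assumes ab: "adjacent a b" "g \<noteq> a" "g \<noteq> b" and up: "level b = level a + 1"
  shows "- pi < angle g b - angle g a - 2 * pi * of_int (crossing g a b)"
    and "angle g b - angle g a - 2 * pi * of_int (crossing g a b) < pi"
proof -
  let ?f = "\<lambda>s. (center s - center g) * Complex 1 1"
  have Im: "Im (?f s) = of_int (level s - level g)"
    and Re: "Re (?f s) = of_int (2 * (fst s - fst g) - (level s - level g))" for s
    by (simp_all add: center_def level_def)
  have ang: "angle g s = Arg (?f s)" for s by (simp add: angle_def)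
  have cr: "crossing g a b = (if level b = level g \<and> fst b < fst g then 1 else 0)"
    using up by (auto simp: crossing_def up_left_def)
  have bd: "- pi < angle g s" "angle g s \<le> pi" for s
    unfolding ang using mpi_less_Arg Arg_le_pi by auto
  have nn: "0 \<le> angle g s \<longleftrightarrow> level g \<le> level s" for s
    unfolding ang Arg_less_0 Im by simp
  have pos: "0 < angle g s \<and> angle g s < pi" if "level g < level s" for s
    unfolding ang Arg_lt_pi Im using that by simp
  have "angle g s = pi" if "level g = level s" "fst s < fst g" for s
    unfolding ang Arg_eq_pi Im Re using that by simp
  moreover have "angle g s = 0" if "level g = level s" "fst g < fst s" for s
    unfolding ang Arg_eq_0_iff complex_is_Real_iff Im Re using that by simp
  ultimately have zero: "angle g b = (if fst b < fst g then pi else 0)" if "level b = level g"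
    using that ab by (auto simp: level_def prod_eq_iff)
  consider "level g \<le> level a" | "level b < level g" | "level b = level g"
    using up by linarith
  then have "- pi < angle g b - angle g a - 2 * pi * of_int (crossing g a b)
    \<and> angle g b - angle g a - 2 * pi * of_int (crossing g a b) < pi"
  proof cases
    case 1
    then show ?thesis using nn[of a] pos[of b] bd[of a] up by (simp add: cr)
  next
    case 2
    then show ?thesis using nn[of a] nn[of b] bd[of a] bd[of b] up by (simp add: cr)
  next
    case 3
    then show ?thesis using nn[of a] bd[of a] up zero by (auto simp: cr)
  qed
  then show "- pi < angle g b - angle g a - 2 * pi * of_int (crossing g a b)"
    and "angle g b - angle g a - 2 * pi * of_int (crossing g a b) < pi" by auto
qed

lemma crossing_swap: "crossing g b a = - crossing g a b"
  by (simp add: crossing_def)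

text \<open>The factor \<open>Complex 1 1\<close> cancels in the quotient of the two vectors, so
  \<open>Re_winding_number_linepath\<close> applies to the corrected angle difference. Downward
  steps reduce to upward ones by symmetry.\<close>

lemma winding_number_edge:
  assumes ab: "adjacent a b" "g \<noteq> a" "g \<noteq> b"
  shows "2 * pi * Re (winding_number (linepath (center a) (center b)) (center g))
    = angle g b - angle g a - 2 * pi * of_int (crossing g a b)"
proof -
  let ?f = "\<lambda>s. (center s - center g) * Complex 1 1"
  have nz: "?f a \<noteq> 0" "?f b \<noteq> 0"
    using ab by (auto simp: center_def complex_eq_iff prod_eq_iff)
  have "- pi < angle g b - angle g a - 2 * pi * of_int (crossing g a b)
    \<and> angle g b - angle g a - 2 * pi * of_int (crossing g a b) < pi"
  proof (cases "level b = level a + 1")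
    case True
    then show ?thesis using Arg_up_step[OF ab] by simp
  next
    case False
    then have "level a = level b + 1" using adjacent_level[OF ab(1)] by auto
    then show ?thesis
      using Arg_up_step[of b a g] ab crossing_swap[of g a b] by (simp add: adjacent_sym)
  qed
  then have "Arg (?f b / ?f a) = angle g b - angle g a - 2 * pi * of_int (crossing g a b)"
    using Arg_divide_shift[OF nz] unfolding angle_def by (simp add: less_imp_le)
  then show ?thesis
    using Re_winding_number_linepath[OF center_notin_edge[OF ab]] by (simp add: complex_eq_iff)
qed

text \<open>Angle differences telescope along the walk. The path properties are part of the claim
  because joining winding numbers in the induction depends on them.\<close>

lemma winding_number_walk:
  assumes "successively adjacent p" "length p \<ge> 2" "g \<notin> set p"
  defines "\<gamma> \<equiv> poly_path (map center p)"
  shows "path \<gamma> \<and> pathstart \<gamma> = center (hd p) \<and> center g \<notin> path_image \<gamma> \<and>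
    2 * pi * Re (winding_number \<gamma> (center g))
      = angle g (last p) - angle g (hd p) - 2 * pi * of_int (crossings g p)"
  using assms(1-3) unfolding \<gamma>_def
proof (induction p)
  case Nil
  then show ?case by simp
next
  case (Cons a p)
  then obtain b q where p: "p = b # q" by (cases p) auto
  have ab: "adjacent a b" "g \<noteq> a" "g \<noteq> b" using Cons.prems p by auto
  note edge = winding_number_edge[OF ab] center_notin_edge[OF ab]
  show ?case
  proof (cases q)
    case Nil
    then show ?thesis using edge p by simp
  next
    case (Cons c q')
    define \<eta> where "\<eta> = poly_path (map center p)"
    have IH: "path \<eta>" "pathstart \<eta> = center b" "center g \<notin> path_image \<eta>"
      "2 * pi * Re (winding_number \<eta> (center g))
         = angle g (last p) - angle g b - 2 * pi * of_int (crossings g p)"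
      using Cons.IH Cons.prems p Cons unfolding \<eta>_def by auto
    have eq: "poly_path (map center (a # p)) = linepath (center a) (center b) +++ \<eta>"
      unfolding \<eta>_def p Cons by simp
    have "winding_number (linepath (center a) (center b) +++ \<eta>) (center g)
        = winding_number (linepath (center a) (center b)) (center g) + winding_number \<eta> (center g)"
      using IH edge by (intro winding_number_join) auto
    then have "2 * pi * Re (winding_number (linepath (center a) (center b) +++ \<eta>) (center g))
      = angle g (last p) - angle g a - 2 * pi * of_int (crossings g (a # p))"
      using IH(4) edge(1) p by (simp add: algebra_simps)
    then show ?thesis
      unfolding eq using IH edge p by (simp add: path_image_join)
  qed
qed

section \<open>Closed walks in the region and potentials\<close>

text \<open>For a closed walk the angle terms cancel, and the winding number is 0 by simple
  connectedness, so only the crossings remain.\<close>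

lemma crossings_closed_walk:
  assumes R: "simply_connected_region R" and g: "g \<notin> R"
    and p: "successively adjacent p" "set p \<subseteq> R" "p \<noteq> []" "hd p = last p"
  shows "crossings g p = 0"
proof (cases "length p \<ge> 2")
  case False
  then obtain a where "p = [a]"
    using p(3) by (cases p; cases "tl p") auto
  then show ?thesis by simp
next
  case True
  \<comment> \<open>\<open>sq_cycle\<close> closes up cyclically, so the repeated last square is
    dropped; \<open>encircles\<close> appends it again.\<close>
  define c where "c = butlast p"
  have len: "length p = Suc (length c)" using True by (simp add: c_def)
  then have cne: "c \<noteq> []" using True by auto
  have hd: "hd c = hd p" using cne unfolding c_def by (metis append_butlast_last_id butlast.simps(1) hd_append2)
  have pc: "p = c @ [hd c]"
    using p(3,4) hd unfolding c_def by simp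
  have "adjacent (c ! i) (c ! (Suc i mod length c))" if i: "i < length c" for i
  proof -
    have "adjacent (p ! i) (p ! Suc i)"
      using p(1) i len by (auto simp: successively_conv_nth)
    moreover have "p ! i = c ! i" using i pc by (metis nth_append)
    moreover have "p ! Suc i = c ! (Suc i mod length c)"
    proof (cases "Suc i = length c")
      case True
      then show ?thesis using pc cne by (metis hd_conv_nth mod_self nth_append_length)
    next
      case False
      then show ?thesis using pc i by (metis Suc_lessI mod_less nth_append)
    qed
    ultimately show ?thesis by simp
  qed
  then have "sq_cycle R c"
    using cne p(2) unfolding sq_cycle_def c_def by (auto dest: in_set_butlastD)
  then have "winding_number (poly_path (map center p)) (center g) = 0"
    using R g pc unfolding simply_connected_region_def encircles_def by metis
  then show ?thesis
    using winding_number_walk[of p g] p True g by auto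
qed

lemma crossings_append:
  assumes "p \<noteq> []" "q \<noteq> []" "last p = hd q"
  shows "crossings g (p @ tl q) = crossings g p + crossings g q"
  using assms
proof (induction p)
  case (Cons a p)
  then show ?case
    by (cases p; cases q; auto)
qed simp

lemma crossings_snoc: "p \<noteq> [] \<Longrightarrow> crossings g (p @ [a]) = crossings g p + crossing g (last p) a"
  using crossings_append[of p "[last p, a]" g] by simp

lemma crossings_rev: "crossings g (rev p) = - crossings g p"
proof (induction p)
  case (Cons a p)
  note IH = Cons.IH
  show ?case
  proof (cases p)
    case (Cons b q)
    have "crossings g (rev (a # p)) = crossings g (rev p) + crossing g b a"
      using crossings_snoc[of "rev p" g a] Cons by (simp add: last_rev)
    then show ?thesis
      using IH crossing_swap[of g a b] Cons by simp
  qed simp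
qed simp

lemma walk_exists:
  assumes "(s, t) \<in> {(u, v). u \<in> R \<and> v \<in> R \<and> adjacent u v}\<^sup>*" "s \<in> R"
  shows "\<exists>p. successively adjacent p \<and> set p \<subseteq> R \<and> p \<noteq> [] \<and> hd p = s \<and> last p = t"
  using assms
proof (induction rule: rtrancl_induct)
  case base
  then show ?case by (intro exI[of _ "[s]"]) auto
next
  case (step t u)
  then obtain p where "successively adjacent p \<and> set p \<subseteq> R \<and> p \<noteq> [] \<and> hd p = s \<and> last p = t"
    by blast
  then show ?case using step
    by (intro exI[of _ "p @ [u]"]) (auto simp: successively_append_iff)
qed

text \<open>Fix a square \<open>s\<close> and let the potential of \<open>t\<close> be the crossings
  of a chosen walk from \<open>s\<close> to \<open>t\<close>. Closed walks have no net crossings, so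
  the value does not depend on the choice.\<close>

lemma potential_exists:
  assumes R: "simply_connected_region R" and g: "g \<notin> R"
  obtains h :: "square \<Rightarrow> int" where
    "\<And>a b. a \<in> R \<Longrightarrow> b \<in> R \<Longrightarrow> adjacent a b \<Longrightarrow> h b = h a + crossing g a b"
proof (cases "R = {}")
  case True
  then show ?thesis using that by blast
next
  case False
  then obtain s where s: "s \<in> R" by blast
  have "\<forall>t\<in>R. \<exists>p. successively adjacent p \<and> set p \<subseteq> R \<and> p \<noteq> [] \<and> hd p = s \<and> last p = t"
    using R s walk_exists unfolding simply_connected_region_def region_def sq_connected_def
    by blast
  then obtain w where w: "\<And>t. t \<in> R \<Longrightarrow> successively adjacent (w t) \<and> set (w t) \<subseteq> R \<and>
      w t \<noteq> [] \<and> hd (w t) = s \<and> last (w t) = t"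
    by metis
  show ?thesis
  proof (rule that[of "\<lambda>t. crossings g (w t)"])
    fix a b assume ab: "a \<in> R" "b \<in> R" "adjacent a b"
    \<comment> \<open>The closed walk from \<open>s\<close> to \<open>a\<close>, over to
      \<open>b\<close> and back to \<open>s\<close>; \<open>tl\<close> drops the repeated
      \<open>b\<close>.\<close>
    define p where "p = (w a @ [b]) @ tl (rev (w b))"
    have rw: "rev (w b) \<noteq> []" "hd (rev (w b)) = b" using w[OF ab(2)] by (auto simp: hd_rev)
    then have q: "rev (w b) = b # tl (rev (w b))" by (metis list.collapse)
    have "successively adjacent (rev (w b))"
      using w[OF ab(2)] by (simp add: adjacent_sym[of "_ :: square"])
    then have "successively adjacent p"
      unfolding p_def using w[OF ab(1)] ab(3) q
      by (metis append_Cons append_Nil append_assoc hd_append2 list.sel(1) not_Cons_self2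
          successively_append_iff)
    moreover have "set p \<subseteq> R"
    proof -
      have "set (tl (rev (w b))) \<subseteq> set (w b)" using rw(1) list.set_sel(2) by fastforce
      then show ?thesis unfolding p_def using w[OF ab(1)] w[OF ab(2)] ab by auto
    qed
    moreover have "hd p = last p"
    proof -
      have "last p = last (rev (w b))"
        unfolding p_def using q by (metis append.assoc append_Cons append_Nil last_appendR list.discI)
      then show ?thesis using w[OF ab(1)] w[OF ab(2)] by (simp add: p_def last_rev)
    qed
    moreover have "p \<noteq> []" by (simp add: p_def)
    ultimately have "crossings g p = 0"
      using crossings_closed_walk[OF R g] by blast
    moreover have "crossings g p = crossings g (w a @ [b]) + crossings g (rev (w b))"
      unfolding p_def using rw by (intro crossings_append) auto
    ultimately show "crossings g (w b) = crossings g (w a) + crossing g a b"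
      using w[OF ab(1)] by (simp add: crossings_snoc crossings_rev)
  qed
qed

section \<open>Ribbon tiles as lattice paths\<close>

text \<open>Levels change by one per step, so a walk from level at most \<open>m\<close> to a level
  above \<open>m\<close> must step from \<open>m\<close> to \<open>m + 1\<close>.\<close>

lemma sq_connected_level_step:
  assumes "sq_connected S" "a \<in> S" "b \<in> S" "level a \<le> m" "m < level b"
  obtains u v where "u \<in> S" "v \<in> S" "adjacent u v" "level u = m" "level v = m + 1"
proof -
  have "(a, b) \<in> {(u, v). u \<in> S \<and> v \<in> S \<and> adjacent u v}\<^sup>*"
    using assms unfolding sq_connected_def by blast
  then have "level b \<le> m \<or>
      (\<exists>u v. u \<in> S \<and> v \<in> S \<and> adjacent u v \<and> level u = m \<and> level v = m + 1)"
  proof (induction rule: rtrancl_induct)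
    case base
    then show ?case using assms by simp
  next
    case (step u v)
    show ?case
    proof (cases "level u \<le> m \<and> m < level v")
      case True
      then have "level u = m" "level v = m + 1" using adjacent_level[of u v] step by auto
      then show ?thesis using step by blast
    next
      case False
      then show ?thesis using step by auto
    qed
  qed
  then show ?thesis using that assms(5) by auto
qed

lemma has_color_iff: "has_color n s c \<longleftrightarrow> level s mod int n = c mod int n"
  by (simp add: has_color_def level_def unique_euclidean_semiring_class.cong_def)

lemma ribbon_tile_bij_betw_colors:
  assumes "n > 0" "ribbon_tile n T"
  shows "bij_betw (\<lambda>s. level s mod int n) T {0..<int n}"
proof -
  have ex: "\<exists>!s. s \<in> T \<and> level s mod int n = c" if "c \<in> {0..<int n}" for c
    using assms(2) that unfolding ribbon_tile_def has_color_iff by (auto simp: mod_pos_pos_trivial)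
  show ?thesis
  proof (rule bij_betw_imageI)
    have "level s mod int n \<in> {0..<int n}" for s using assms(1) by simp
    then show "inj_on (\<lambda>s. level s mod int n) T"
      using ex unfolding inj_on_def by blast
    show "(\<lambda>s. level s mod int n) ` T = {0..<int n}"
    proof
      show "(\<lambda>s. level s mod int n) ` T \<subseteq> {0..<int n}" using assms(1) by auto
      show "{0..<int n} \<subseteq> (\<lambda>s. level s mod int n) ` T"
      proof
        fix c assume "c \<in> {0..<int n}"
        then obtain s where "s \<in> T" "level s mod int n = c" using ex by blast
        then show "c \<in> (\<lambda>s. level s mod int n) ` T" by blast
      qed
    qed
  qed
qed

text \<open>Distinct colors make the levels of \<open>T\<close> distinct, connectedness leaves no
  gap between the lowest and the highest, and there are \<open>n\<close> squares: hence
  \<open>n\<close> consecutive levels with one square each.\<close>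

lemma ribbon_tile_path:
  assumes "n > 0" "ribbon_tile n T"
  obtains l p where "T = (\<lambda>m. (p m, m - p m)) ` {l..<l + int n}"
    "\<And>m. l \<le> m \<Longrightarrow> m + 1 < l + int n \<Longrightarrow> p (m + 1) = p m \<or> p (m + 1) = p m + 1"
proof -
  note bij = ribbon_tile_bij_betw_colors[OF assms]
  have con: "sq_connected T" using assms(2) by (simp add: ribbon_tile_def)
  have fin: "finite T" using bij_betw_finite[OF bij] by simp
  have cardT: "card T = n" using bij_betw_same_card[OF bij] by simp
  have inj: "inj_on level T" using bij_betw_imp_inj_on[OF bij] by (auto simp: inj_on_def)
  have ne: "T \<noteq> {}" using cardT assms(1) by auto
  define l where "l = Min (level ` T)"
  define u where "u = Max (level ` T)"
  have lT: "l \<in> level ` T" and uT: "u \<in> level ` T"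
    unfolding l_def u_def using fin ne by simp_all
  have step: "\<exists>a b. a \<in> T \<and> b \<in> T \<and> adjacent a b \<and> level a = m \<and> level b = m + 1"
    if "l \<le> m" "m < u" for m
  proof -
    obtain a b where "a \<in> T" "b \<in> T" "level a = l" "level b = u" using lT uT by blast
    then show ?thesis using sq_connected_level_step[OF con, of a b m] that by metis
  qed
  have "level ` T = {l..u}"
  proof
    show "level ` T \<subseteq> {l..u}" unfolding l_def u_def using fin by auto
    show "{l..u} \<subseteq> level ` T"
    proof
      fix m assume "m \<in> {l..u}"
      then show "m \<in> level ` T" using step[of m] uT by (cases "m = u") auto
    qed
  qed
  moreover have "card (level ` T) = n" using card_image[OF inj] cardT by simp
  ultimately have levels: "level ` T = {l..<l + int n}" and u: "u = l + int n - 1"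
    using assms(1) by auto
  define p where "p m = fst (the_inv_into T level m)" for m
  have inv: "the_inv_into T level m = (p m, m - p m)" if "m \<in> level ` T" for m
    using f_the_inv_into_f[OF inj that] by (auto simp: p_def level_def prod_eq_iff)
  show ?thesis
  proof (rule that)
    have "T = the_inv_into T level ` level ` T"
      using the_inv_into_onto[OF inj] by simp
    then show "T = (\<lambda>m. (p m, m - p m)) ` {l..<l + int n}"
      using inv levels by (metis (no_types, lifting) image_cong)
    fix m assume "l \<le> m" "m + 1 < l + int n"
    then obtain a b where ab: "a \<in> T" "b \<in> T" "adjacent a b" "level a = m" "level b = m + 1"
      using step[of m] u by auto
    then have "p m = fst a" "p (m + 1) = fst b"
      unfolding p_def using the_inv_into_f_f[OF inj] by metis+
    then show "p (m + 1) = p m \<or> p (m + 1) = p m + 1"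
      using ab adjacent_level[of a b] by auto
  qed
qed

text \<open>Converse of \<open>ribbon_tile_path\<close>; it turns labelled data back into tiles, in
  particular after an exchange.\<close>

lemma ribbon_tile_of_path:
  assumes "n > 0"
    and step: "\<And>m. l \<le> m \<Longrightarrow> m + 1 < l + int n \<Longrightarrow> p (m + 1) = p m \<or> p (m + 1) = p m + 1"
  shows "ribbon_tile n ((\<lambda>m. (p m, m - p m)) ` {l..<l + int n})"
proof -
  define f where "f = (\<lambda>m. (p m, m - p m))"
  define T where "T = f ` {l..<l + int n}"
  define r where "r = {(u, v). u \<in> T \<and> v \<in> T \<and> adjacent u v}"
  have lev: "level (f m) = m" for m by (simp add: f_def level_def)
  have "(f l, f m) \<in> r\<^sup>*" if "l \<le> m" "m < l + int n" for m
    using that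
  proof (induction m rule: int_ge_induct)
    case (step m)
    have "(f m, f (m + 1)) \<in> r"
    proof -
      have "f m \<in> T" "f (m + 1) \<in> T" using step by (auto simp: T_def)
      moreover have "adjacent (f m) (f (m + 1))"
        using step assms(2)[of m] unfolding adjacent_iff_level lev by (auto simp: f_def)
      ultimately show ?thesis by (simp add: r_def)
    qed
    then show ?case using step by (auto intro: rtrancl_into_rtrancl)
  qed simp
  moreover have "sym (r\<^sup>*)"
    by (intro sym_rtrancl) (auto simp: sym_def r_def adjacent_sym)
  ultimately have "(f k, f m) \<in> r\<^sup>*"
    if "l \<le> k" "k < l + int n" "l \<le> m" "m < l + int n" for k m
    using that by (meson rtrancl_trans symD)
  then have "(s, t) \<in> r\<^sup>*" if "s \<in> T" "t \<in> T" for s t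
    using that unfolding T_def by auto
  then have con: "sq_connected T" unfolding sq_connected_def r_def by blast
  have "\<exists>!s. s \<in> T \<and> has_color n s c" if "c \<in> {0..<int n}" for c
  proof -
    \<comment> \<open>The only level of the tile that is congruent to \<open>c\<close>.\<close>
    define m where "m = l + (c - l) mod int n"
    have m: "l \<le> m" "m < l + int n" "m mod int n = c mod int n"
      using assms(1) by (simp_all add: m_def mod_add_right_eq)
    have "m' = m" if "l \<le> m'" "m' < l + int n" "m' mod int n = c mod int n" for m'
    proof -
      have "m' mod int n = m mod int n" using that m by simp
      then have "int n dvd m' - m" by (simp only: mod_eq_dvd_iff)
      then have "\<bar>m' - m\<bar> < int n \<Longrightarrow> m' - m = 0" using dvd_imp_le_int[of "m' - m" "int n"] by auto
      then show ?thesis using that m by auto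
    qed
    moreover have "f m \<in> T" using m by (simp add: T_def)
    ultimately show ?thesis
      unfolding has_color_iff using m(3) lev by (intro ex1I[of _ "f m"]) (auto simp only: T_def atLeastLessThan_iff)
  qed
  then show ?thesis using con unfolding ribbon_tile_def T_def f_def by blast
qed

section \<open>Labelled tilings\<close>

definition index :: "(int \<Rightarrow> nat) \<Rightarrow> (int \<times> nat) set" where
  "index t = {i. snd i < t (fst i)}"

text \<open>\<open>P\<close> is a total function, but only its values at these pairs carry
  information.\<close>

definition cells :: "nat \<Rightarrow> (int \<Rightarrow> nat) \<Rightarrow> ((int \<times> nat) \<times> int) set" where
  "cells n t = {(i, m). i \<in> index t \<and> fst i \<le> m \<and> m < fst i + int n}"

definition cell :: "(int \<times> nat \<Rightarrow> int \<Rightarrow> int) \<Rightarrow> int \<times> nat \<Rightarrow> int \<Rightarrow> square" where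
  "cell P i m = (P i m, m - P i m)"

text \<open>The index \<open>(l, j)\<close> stands for the \<open>j\<close>-th tile from the left among the \<open>t l\<close> tiles whose
  lowest square is on level \<open>l\<close>, and \<open>P i m\<close> is the first coordinate of the square
  of tile \<open>i\<close> on level \<open>m\<close>.\<close>
locale labelled =
  fixes n :: nat and R :: "square set" and t :: "int \<Rightarrow> nat"
    and P :: "int \<times> nat \<Rightarrow> int \<Rightarrow> int"
  assumes n_pos: "n > 0" and finite_R: "finite R"
    and step: "\<And>i m. i \<in> index t \<Longrightarrow> fst i \<le> m \<Longrightarrow> m + 1 < fst i + int n \<Longrightarrow>
      P i (m + 1) = P i m \<or> P i (m + 1) = P i m + 1"
    and bij: "bij_betw (\<lambda>(i, m). cell P i m) (cells n t) R"
    and sorted: "\<And>l j k. j < k \<Longrightarrow> k < t l \<Longrightarrow> P (l, j) l < P (l, k) l"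

definition tile :: "nat \<Rightarrow> (int \<times> nat \<Rightarrow> int \<Rightarrow> int) \<Rightarrow> int \<times> nat \<Rightarrow> square set" where
  "tile n P i = cell P i ` {fst i..<fst i + int n}"

definition tiles :: "nat \<Rightarrow> (int \<Rightarrow> nat) \<Rightarrow> (int \<times> nat \<Rightarrow> int \<Rightarrow> int) \<Rightarrow> square set set" where
  "tiles n t P = tile n P ` index t"

lemma level_cell [simp]: "level (cell P i m) = m"
  by (simp add: cell_def level_def)

lemma fst_cell [simp]: "fst (cell P i m) = P i m"
  by (simp add: cell_def)

lemma eq_cell_iff: "s = cell P i m \<longleftrightarrow> level s = m \<and> fst s = P i m"
  by (auto simp: cell_def level_def prod_eq_iff)

context labelled
begin

lemma cell_in_R: "i \<in> index t \<Longrightarrow> fst i \<le> m \<Longrightarrow> m < fst i + int n \<Longrightarrow> cell P i m \<in> R"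
  using bij_betw_apply[OF bij, of "(i, m)"] by (simp add: cells_def)

lemma R_cases:
  assumes "s \<in> R"
  obtains i where "i \<in> index t" "fst i \<le> level s" "level s < fst i + int n" "s = cell P i (level s)"
proof -
  have "s \<in> (\<lambda>(i, m). cell P i m) ` cells n t" using bij assms by (simp add: bij_betw_def)
  then obtain i m where "(i, m) \<in> cells n t" "s = cell P i m" by auto
  then show ?thesis using that[of i] by (simp add: cells_def)
qed

lemma inj:
  assumes "i \<in> index t" "fst i \<le> m" "m < fst i + int n"
    "j \<in> index t" "fst j \<le> m" "m < fst j + int n" "P i m = P j m"
  shows "i = j"
proof -
  have "cell P i m = cell P j m" using assms by (simp add: cell_def)
  then show ?thesis
    using bij_betw_imp_inj_on[OF bij, THEN inj_onD, of "(i, m)" "(j, m)"] assms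
    by (auto simp: cells_def)
qed

lemma ribbon_tile_tile: "i \<in> index t \<Longrightarrow> ribbon_tile n (tile n P i)"
  unfolding tile_def cell_def using n_pos step by (intro ribbon_tile_of_path) auto

lemma ribbon_tiling_tiles: "ribbon_tiling n R (tiles n t P)"
  unfolding ribbon_tiling_def
proof
  show "partition_on R (tiles n t P)"
    unfolding partition_on_def
  proof (intro conjI)
    show "\<Union> (tiles n t P) = R"
    proof
      show "\<Union> (tiles n t P) \<subseteq> R" by (auto simp: tiles_def tile_def cell_in_R)
      show "R \<subseteq> \<Union> (tiles n t P)"
      proof
        fix s assume "s \<in> R"
        then obtain i where "i \<in> index t" "fst i \<le> level s" "level s < fst i + int n"
          "s = cell P i (level s)" by (rule R_cases)
        then show "s \<in> \<Union> (tiles n t P)"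
          unfolding tiles_def tile_def by fastforce
      qed
    qed
    show "disjoint (tiles n t P)"
    proof (rule disjointI)
      fix S T assume "S \<in> tiles n t P" "T \<in> tiles n t P" "S \<noteq> T"
      then obtain i j where ij: "i \<in> index t" "j \<in> index t" "S = tile n P i" "T = tile n P j" "i \<noteq> j"
        by (auto simp: tiles_def)
      have False if s: "s \<in> S" "s \<in> T" for s
      proof -
        obtain m k where "fst i \<le> m" "m < fst i + int n" "fst j \<le> k" "k < fst j + int n"
          "cell P i m = cell P j k"
          using s ij by (auto simp: tile_def)
        moreover from this(5) have "m = k" "P i m = P j k" by (auto simp: eq_cell_iff)
        ultimately show False using inj ij by blast
      qed
      then show "S \<inter> T = {}" by blast
    qed
    show "{} \<notin> tiles n t P" using n_pos by (auto simp: tiles_def tile_def)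
  qed
  show "\<forall>T\<in>tiles n t P. ribbon_tile n T" by (auto simp: tiles_def ribbon_tile_tile)
qed

lemma finite_cells: "finite (cells n t)"
  using bij_betw_finite[OF bij] finite_R by simp

lemma finite_index: "finite (index t)"
proof -
  have "index t \<subseteq> fst ` cells n t"
  proof
    fix i assume "i \<in> index t"
    then have "(i, fst i) \<in> cells n t" using n_pos by (simp add: cells_def)
    then show "i \<in> fst ` cells n t" by force
  qed
  then show ?thesis using finite_cells finite_surj by blast
qed

text \<open>A tile reaches level \<open>m\<close> exactly when it starts on one of the
  \<open>n\<close> levels ending at \<open>m\<close>.\<close>

lemma card_level: "card {s \<in> R. level s = m} = (\<Sum>l\<in>{m - int n<..m}. t l)"
proof -
  have "bij_betw (\<lambda>i. cell P i m) (SIGMA l:{m - int n<..m}. {..<t l}) {s \<in> R. level s = m}"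
  proof (rule bij_betw_imageI)
    show "inj_on (\<lambda>i. cell P i m) (SIGMA l:{m - int n<..m}. {..<t l})"
    proof (rule inj_onI)
      fix i j assume "i \<in> (SIGMA l:{m - int n<..m}. {..<t l})" "j \<in> (SIGMA l:{m - int n<..m}. {..<t l})"
        "cell P i m = cell P j m"
      then show "i = j" using inj[of i m j] fst_cell[of P i m] fst_cell[of P j m]
        by (auto simp: index_def)
    qed
    show "(\<lambda>i. cell P i m) ` (SIGMA l:{m - int n<..m}. {..<t l}) = {s \<in> R. level s = m}"
    proof
      show "(\<lambda>i. cell P i m) ` (SIGMA l:{m - int n<..m}. {..<t l}) \<subseteq> {s \<in> R. level s = m}"
        by (auto simp: index_def intro!: cell_in_R)
      show "{s \<in> R. level s = m} \<subseteq> (\<lambda>i. cell P i m) ` (SIGMA l:{m - int n<..m}. {..<t l})"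
      proof
        fix s assume s: "s \<in> {s \<in> R. level s = m}"
        then have "s \<in> R" by simp
        then obtain i where i: "i \<in> index t" "fst i \<le> level s" "level s < fst i + int n"
          "s = cell P i (level s)" by (rule R_cases)
        then have "i \<in> (SIGMA l:{m - int n<..m}. {..<t l})"
          using s by (cases i) (auto simp: index_def)
        then show "s \<in> (\<lambda>i. cell P i m) ` (SIGMA l:{m - int n<..m}. {..<t l})"
          using i s by blast
      qed
    qed
  qed
  from bij_betw_same_card[OF this] show ?thesis by simp
qed

lemma t_eq_0: 
  assumes "\<And>s. s \<in> R \<Longrightarrow> l < level s"
  shows "t l = 0"
proof (rule ccontr)
  assume "t l \<noteq> 0"
  then have "cell P (l, 0) l \<in> R" using n_pos by (intro cell_in_R) (auto simp: index_def)
  then show False using assms by fastforce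
qed

end

section \<open>Uniqueness of the counts and existence of a labelling\<close>

text \<open>By \<open>card_level\<close>, the count at \<open>l\<close> is determined by
  \<open>R\<close> and the counts on the \<open>n - 1\<close> levels below. This recursion starts
  below all squares of \<open>R\<close>, where no tile starts.\<close>

lemma labelled_counts_unique:
  assumes "labelled n R t P" "labelled n R t' Q"
  shows "t = t'"
proof
  interpret P: labelled n R t P by fact
  interpret Q: labelled n R t' Q by fact
  obtain L where L: "\<And>s. s \<in> R \<Longrightarrow> L < level s"
  proof (cases "R = {}")
    case False
    have "Min (level ` R) - 1 < level s" if "s \<in> R" for s
    proof -
      have "Min (level ` R) \<le> level s" using P.finite_R that by (intro Min_le) auto
      then show ?thesis by linarith
    qed
    then show ?thesis using that by blast
  qed (use that in auto)
  \<comment> \<open>\<open>nat\<close> sends every level up to \<open>L\<close> to 0, so this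
    induction reaches all integer levels.\<close>
  have "\<forall>l. nat (l - L) = k \<longrightarrow> t l = t' l" for k
  proof (induction k rule: less_induct)
    case (less k)
    show ?case
    proof (intro allI impI)
      fix l assume l: "nat (l - L) = k"
      show "t l = t' l"
      proof (cases "l \<le> L")
        case True
        then have "\<And>s. s \<in> R \<Longrightarrow> l < level s" using L by force
        then show ?thesis using P.t_eq_0 Q.t_eq_0 by metis
      next
        case False
        have eq: "t i = t' i" if "i < l" for i
        proof (cases "i \<le> L")
          case True
          then have "\<And>s. s \<in> R \<Longrightarrow> i < level s" using L by force
          then show ?thesis using P.t_eq_0 Q.t_eq_0 by metis
        next
          case False
          then show ?thesis using less[of "nat (i - L)"] that l by auto
        qed
        have "{l - int n<..l} = insert l {l - int n<..<l}" using P.n_pos by auto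
        then have "t l + (\<Sum>i\<in>{l - int n<..<l}. t i) = t' l + (\<Sum>i\<in>{l - int n<..<l}. t' i)"
          using P.card_level[of l] Q.card_level[of l] by simp
        moreover have "(\<Sum>i\<in>{l - int n<..<l}. t i) = (\<Sum>i\<in>{l - int n<..<l}. t' i)"
          using eq by (intro sum.cong) auto
        ultimately show ?thesis by simp
      qed
    qed
  qed
  then show "t l = t' l" for l by blast
qed

lemma ex_sorted_enumeration:
  fixes f :: "'a \<Rightarrow> 'b::linorder"
  assumes "finite A" "inj_on f A"
  shows "\<exists>e. bij_betw e {..<card A} A \<and> (\<forall>i j. i < j \<longrightarrow> j < card A \<longrightarrow> f (e i) < f (e j))"
proof -
  define xs where "xs = sorted_list_of_set (f ` A)"
  have len: "length xs = card A" using assms by (simp add: xs_def card_image)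
  have bx: "bij_betw (nth xs) {..<card A} (f ` A)"
    using assms len by (intro bij_betw_nth) (auto simp: xs_def)
  have bg: "bij_betw (the_inv_into A f) (f ` A) A"
    using assms by (intro bij_betw_the_inv_into) (simp add: bij_betw_def)
  have "f (the_inv_into A f (xs ! i)) = xs ! i" if "i < card A" for i
    using bij_betw_apply[OF bx, of i] that assms by (intro f_the_inv_into_f) auto
  moreover have "xs ! i < xs ! j" if "i < j" "j < card A" for i j
    using that len strict_sorted_list_of_set[of "f ` A"]
    unfolding xs_def[symmetric] by (simp add: sorted_wrt_iff_nth_less)
  ultimately have "f (the_inv_into A f (xs ! i)) < f (the_inv_into A f (xs ! j))"
    if "i < j" "j < card A" for i j
    using that by simp
  then show ?thesis
    using bij_betw_trans[OF bx bg] by (intro exI[of _ "the_inv_into A f \<circ> nth xs"]) auto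
qed

text \<open>Each tile gets its lowest level and its path; tiles with a common lowest level are
  numbered by their columns there, which differ because tiles are disjoint.\<close>

lemma ribbon_tiling_labelled:
  assumes n: "n > 0" and fin: "finite R" and \<alpha>: "ribbon_tiling n R \<alpha>"
  obtains t P where "labelled n R t P" "tiles n t P = \<alpha>"
proof -
  have part: "partition_on R \<alpha>" and rib: "\<And>T. T \<in> \<alpha> \<Longrightarrow> ribbon_tile n T"
    using \<alpha> by (auto simp: ribbon_tiling_def)
  have fin\<alpha>: "finite \<alpha>" using finite_elements[OF fin part] .
  define path where "path T l p \<longleftrightarrow> T = (\<lambda>m. (p m, m - p m)) ` {l..<l + int n} \<and>
    (\<forall>m. l \<le> m \<longrightarrow> m + 1 < l + int n \<longrightarrow> p (m + 1) = p m \<or> p (m + 1) = p m + 1)" for T l p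
  have "\<forall>T\<in>\<alpha>. \<exists>l p. path T l p"
    unfolding path_def using ribbon_tile_path[OF n rib] by metis
  then obtain lo p where lop: "\<And>T. T \<in> \<alpha> \<Longrightarrow> path T (lo T) (p T)"
    by metis
  have mem: "(p T m, m - p T m) \<in> T" if "T \<in> \<alpha>" "lo T \<le> m" "m < lo T + int n" for T m
  proof -
    have "T = (\<lambda>m. (p T m, m - p T m)) ` {lo T..<lo T + int n}"
      using lop[OF that(1)] by (simp add: path_def)
    moreover have "(p T m, m - p T m) \<in> (\<lambda>m. (p T m, m - p T m)) ` {lo T..<lo T + int n}"
      using that by (intro imageI) simp
    ultimately show ?thesis by metis
  qed
  have same: "S = T" if "S \<in> \<alpha>" "lo S \<le> m" "m < lo S + int n" "T \<in> \<alpha>" "lo T \<le> m" "m < lo T + int n"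
    "p S m = p T m" for S T m
    using mem[of S m] mem[of T m] that partition_onD2[OF part] unfolding disjoint_def
    by (metis IntI empty_iff)
  define A where "A l = {T \<in> \<alpha>. lo T = l}" for l
  define t where "t l = card (A l)" for l
  have "\<forall>l. \<exists>e. bij_betw e {..<t l} (A l) \<and> (\<forall>i j. i < j \<longrightarrow> j < t l \<longrightarrow> p (e i) l < p (e j) l)"
  proof
    fix l
    have "inj_on (\<lambda>T. p T l) (A l)" using same[of _ l] n by (auto simp: inj_on_def A_def)
    then show "\<exists>e. bij_betw e {..<t l} (A l) \<and> (\<forall>i j. i < j \<longrightarrow> j < t l \<longrightarrow> p (e i) l < p (e j) l)"
      unfolding t_def using fin\<alpha> by (intro ex_sorted_enumeration) (auto simp: A_def)
  qed
  from choice[OF this] obtain e where e: "\<And>l. bij_betw (e l) {..<t l} (A l)"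
    "\<And>l i j. i < j \<Longrightarrow> j < t l \<Longrightarrow> p (e l i) l < p (e l j) l" by blast
  define E where "E i = e (fst i) (snd i)" for i
  have E: "E i \<in> \<alpha>" "lo (E i) = fst i" if "i \<in> index t" for i
    using bij_betw_apply[OF e(1), of "snd i" "fst i"] that by (auto simp: index_def E_def A_def)
  have Einj: "i = j" if "i \<in> index t" "j \<in> index t" "E i = E j" for i j
  proof -
    have "fst i = fst j" using E that by metis
    then show ?thesis
      using bij_betw_imp_inj_on[OF e(1), of "fst i", THEN inj_onD, of "snd i" "snd j"] that
      by (auto simp: E_def index_def prod_eq_iff)
  qed
  have Esurj: "\<exists>i\<in>index t. E i = T" if "T \<in> \<alpha>" for T
  proof -
    have "T \<in> e (lo T) ` {..<t (lo T)}"
      using bij_betw_imp_surj_on[OF e(1), of "lo T"] that by (simp add: A_def)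
    then show ?thesis by (auto simp: E_def index_def intro!: bexI[of _ "(lo T, _)"])
  qed
  define P where "P i = p (E i)" for i
  have tile: "tile n P i = E i" if "i \<in> index t" for i
  proof -
    have "tile n P i = (\<lambda>m. (p (E i) m, m - p (E i) m)) ` {lo (E i)..<lo (E i) + int n}"
      using E(2)[OF that] by (simp add: tile_def cell_def[abs_def] P_def)
    also have "\<dots> = E i" using lop[OF E(1)[OF that]] unfolding path_def by (elim conjE) (rule sym)
    finally show ?thesis .
  qed
  show ?thesis
  proof (rule that)
    show "tiles n t P = \<alpha>"
    proof -
      have "tiles n t P = E ` index t" unfolding tiles_def using tile by (intro image_cong) auto
      moreover have "E ` index t \<subseteq> \<alpha>" using E(1) by auto
      moreover have "\<alpha> \<subseteq> E ` index t"
      proof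
        fix T assume "T \<in> \<alpha>"
        then obtain i where "i \<in> index t" "E i = T" using Esurj by metis
        then show "T \<in> E ` index t" by (metis imageI)
      qed
      ultimately show ?thesis by simp
    qed
    show "labelled n R t P"
    proof
      show "n > 0" "finite R" by fact+
      show "P i (m + 1) = P i m \<or> P i (m + 1) = P i m + 1"
        if "i \<in> index t" "fst i \<le> m" "m + 1 < fst i + int n" for i m
        using lop[OF E(1)[OF that(1)]] E(2)[OF that(1)] that by (simp add: P_def path_def)
      show "P (l, j) l < P (l, k) l" if "j < k" "k < t l" for l j k
        using e(2)[OF that] by (simp add: P_def E_def)
      show "bij_betw (\<lambda>(i, m). cell P i m) (cells n t) R"
      proof (rule bij_betw_imageI)
        show "inj_on (\<lambda>(i, m). cell P i m) (cells n t)"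
        proof (rule inj_onI)
          fix x y assume xy: "x \<in> cells n t" "y \<in> cells n t"
            "(\<lambda>(i, m). cell P i m) x = (\<lambda>(i, m). cell P i m) y"
          obtain i m j k where [simp]: "x = (i, m)" "y = (j, k)" by (cases x, cases y) blast
          have c: "cell P i m = cell P j k" using xy by simp
          then have [simp]: "k = m" by (metis level_cell)
          have "P i m = P j m" using c by (metis fst_cell \<open>k = m\<close>)
          then have "E i = E j" using same[of "E i" m "E j"] xy E by (auto simp: cells_def P_def)
          then show "x = y" using Einj xy by (auto simp: cells_def)
        qed
        have "R = \<Union> \<alpha>" using partition_onD1[OF part] .
        also have "\<dots> = (\<Union>i\<in>index t. tile n P i)" using \<open>tiles n t P = \<alpha>\<close> by (auto simp: tiles_def)
        also have "\<dots> = (\<lambda>(i, m). cell P i m) ` cells n t"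
          unfolding tile_def cells_def by force
        finally show "(\<lambda>(i, m). cell P i m) ` cells n t = R" by simp
      qed
    qed
  qed
qed

section \<open>The zigzag between two levels\<close>

text \<open>The squares on levels \<open>m - 1\<close> and \<open>m\<close> form an infinite zigzag of consecutively adjacent
  squares. Its square \<open>s\<close> gets the coordinate \<open>2 * fst s + (m - level s)\<close>; a tile is located by
  its square on level \<open>m\<close>, or by its last square if that is on level \<open>m - 1\<close>.\<close>
definition zig :: "nat \<Rightarrow> (int \<times> nat \<Rightarrow> int \<Rightarrow> int) \<Rightarrow> int \<times> nat \<Rightarrow> int \<Rightarrow> int" where
  "zig n P i m = (if m < fst i + int n then 2 * P i m else 2 * P i (m - 1) + 1)"

text \<open>The upper bound is inclusive, so a tile ending on level \<open>m - 1\<close> and one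
  starting on \<open>m\<close> lie on a common zigzag and can be compared.\<close>

definition meets :: "nat \<Rightarrow> int \<times> nat \<Rightarrow> int \<Rightarrow> bool" where
  "meets n i m \<longleftrightarrow> fst i \<le> m \<and> m \<le> fst i + int n"

lemma sum_of_bool_eq:
  assumes "finite A"
  shows "(\<Sum>q\<in>A. of_bool (q = m \<and> Q q)) = (of_bool (m \<in> A \<and> Q m) :: int)"
proof -
  have "(\<Sum>q\<in>A. of_bool (q = m \<and> Q q)) = (\<Sum>q\<in>A. if q = m then of_bool (Q m) else (0 :: int))"
    by (intro sum.cong) auto
  then show ?thesis using assms by (simp add: sum.delta)
qed

lemma down_closed_eq_lessThan:
  fixes A :: "nat set"
  assumes "finite A" "\<And>j k. j < k \<Longrightarrow> k \<in> A \<Longrightarrow> j \<in> A"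
  shows "A = {..<card A}"
proof (cases "A = {}")
  case False
  have "A = {..Max A}"
  proof
    show "A \<subseteq> {..Max A}" using assms(1) by auto
    show "{..Max A} \<subseteq> A"
      using assms(2)[of _ "Max A"] Max_in[OF assms(1) False] by (auto simp: le_less)
  qed
  then show ?thesis by (metis card_atMost lessThan_Suc_atMost)
qed simp

lemma initial_segment_eqI:
  fixes A B :: "nat set"
  assumes "A = {..<card A}" "B = {..<card B}" "int (card A) = int (card B)"
  shows "A = B"
  using assms by (metis of_nat_eq_iff)

context labelled
begin

abbreviation z :: "int \<times> nat \<Rightarrow> int \<Rightarrow> int" where "z \<equiv> zig n P"

text \<open>Even coordinates belong to squares on level \<open>m\<close>, odd ones to last squares
  on level \<open>m - 1\<close>. Equal coordinates thus mean a common square.\<close>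

lemma zig_inj:
  assumes "i \<in> index t" "j \<in> index t" "meets n i m" "meets n j m" "z i m = z j m"
  shows "i = j"
proof -
  have "(m < fst i + int n \<and> m < fst j + int n \<and> P i m = P j m)
    \<or> (m = fst i + int n \<and> m = fst j + int n \<and> P i (m - 1) = P j (m - 1))"
    using assms(3-5) unfolding zig_def meets_def by (auto split: if_splits) presburger+
  then show ?thesis
    using inj[of i m j] inj[of i "m - 1" j] assms n_pos by (auto simp: meets_def)
qed

text \<open>One level up, the coordinate lies between \<open>2 * P k m\<close> and
  \<open>2 * P k m + 2\<close>. For distinct columns these ranges overlap in at most an endpoint,
  and \<open>zig_inj\<close> excludes equality.\<close>

lemma zig_less_step:
  assumes ij: "i \<in> index t" "j \<in> index t"
    and m: "meets n i m" "meets n j m" "meets n i (m + 1)" "meets n j (m + 1)"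
    and less: "z i m < z j m"
  shows "z i (m + 1) < z j (m + 1)"
proof -
  have "m < fst i + int n" "m < fst j + int n" using m by (auto simp: meets_def)
  then have "P i m < P j m" using less by (simp add: zig_def)
  have bounds: "z k (m + 1) \<in> {2 * P k m .. 2 * P k m + 2}"
    if "k \<in> index t" "meets n k m" "meets n k (m + 1)" for k
  proof (cases "m + 1 = fst k + int n")
    case True
    then have "\<not> m + 1 < fst k + int n" by simp
    then show ?thesis by (simp add: zig_def)
  next
    case False
    then show ?thesis using step[of k m] that by (auto simp: zig_def meets_def)
  qed
  have "z i (m + 1) \<le> z j (m + 1)"
    using \<open>P i m < P j m\<close> bounds[OF ij(1) m(1,3)] bounds[OF ij(2) m(2,4)] by simp
  moreover have "i \<noteq> j" using less by auto
  then have "z i (m + 1) \<noteq> z j (m + 1)" using zig_inj[of i j "m + 1"] ij m by auto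
  ultimately show ?thesis by simp
qed

lemma zig_less_up:
  assumes "i \<in> index t" "j \<in> index t" "z i m < z j m" "m \<le> k"
    "meets n i m" "meets n j m" "meets n i k" "meets n j k"
  shows "z i k < z j k"
  using assms(4,3,5-)
proof (induction k rule: int_ge_induct)
  case (step k)
  then have "meets n i k" "meets n j k" by (auto simp: meets_def)
  then show ?case using zig_less_step[of i j k] step assms(1,2) by auto
qed simp

text \<open>Two tiles never swap sides, so it does not matter on which zigzag they are compared.
  Downwards this follows from the upward case with the roles exchanged.\<close>

lemma zig_less:
  assumes "i \<in> index t" "j \<in> index t" "z i m < z j m"
    "meets n i m" "meets n j m" "meets n i k" "meets n j k"
  shows "z i k < z j k"
proof (cases "m \<le> k")
  case True
  then show ?thesis using zig_less_up assms by blast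
next
  case False
  have "i \<noteq> j" using assms by auto
  then have "z i k \<noteq> z j k" using zig_inj assms by blast
  moreover have "\<not> z j k < z i k"
    using zig_less_up[of j i k m] False assms by auto
  ultimately show ?thesis by simp
qed

lemma zig_mono_label:
  assumes "j < k" "k < t l" "meets n (l, k) m"
  shows "z (l, j) m < z (l, k) m"
proof -
  have "z (l, j) l < z (l, k) l"
    using sorted[OF assms(1,2)] n_pos by (simp add: zig_def)
  then show ?thesis
    using assms zig_less[of "(l, j)" "(l, k)" l m] by (simp add: index_def meets_def)
qed

text \<open>Labels increase from left to right on every zigzag. The number of these tiles therefore
  determines which tiles they are; this is how invariant counts fix individual tiles.\<close>

lemma zig_less_set:
  assumes "meets n (l, 0) m"
  shows "{k. k < t l \<and> z (l, k) m < x} = {..<card {k. k < t l \<and> z (l, k) m < x}}"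
proof (rule down_closed_eq_lessThan)
  fix j k assume jk: "j < k" "k \<in> {k. k < t l \<and> z (l, k) m < x}"
  then have "z (l, j) m < z (l, k) m"
    using assms by (intro zig_mono_label) (auto simp: meets_def)
  then show "j \<in> {k. k < t l \<and> z (l, k) m < x}" using jk by auto
qed simp

lemma sum_R:
  "(\<Sum>s\<in>R. f s) = (\<Sum>i\<in>index t. \<Sum>m\<in>{fst i..<fst i + int n}. (f (cell P i m) :: int))"
proof -
  have "cells n t = (SIGMA i:index t. {fst i..<fst i + int n})" by (auto simp: cells_def)
  moreover have "(\<Sum>s\<in>R. f s) = (\<Sum>x\<in>cells n t. f (case x of (i, m) \<Rightarrow> cell P i m))"
    using sum.reindex_bij_betw[OF bij, of f] by simp
  ultimately show ?thesis
    using finite_index by (simp add: sum.Sigma case_prod_unfold)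
qed

lemma sum_index_card:
  "(\<Sum>i\<in>index t. of_bool (fst i = l \<and> Q i)) = int (card {k. k < t l \<and> Q (l, k)})"
proof -
  have "(\<Sum>i\<in>index t. of_bool (fst i = l \<and> Q i)) = int (card {i \<in> index t. fst i = l \<and> Q i})"
    using finite_index by (simp add: of_bool_def sum.If_cases Int_def)
  also have "{i \<in> index t. fst i = l \<and> Q i} = Pair l ` {k. k < t l \<and> Q (l, k)}"
    by (auto simp: index_def image_iff)
  also have "card \<dots> = card {k. k < t l \<and> Q (l, k)}"
    by (intro card_image) (auto simp: inj_on_def)
  finally show ?thesis .
qed

end

section \<open>Each tile passes a missing square on the same side in all tilings\<close>

text \<open>If \<open>g\<close> is on level \<open>m\<close>, this is the potential itself. If it is
  on level \<open>m - 1\<close>, the jump comes one level too early, and subtracting 1 on level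
  \<open>m - 1\<close> left of \<open>g\<close> moves it up; no square of \<open>R\<close> sits at
  \<open>g\<close> itself, so left and right stay separated.\<close>

lemma potential_on_zigzag:
  assumes R: "simply_connected_region R" and g: "g \<notin> R" and m: "level g = m \<or> level g = m - 1"
  obtains h :: "square \<Rightarrow> int" where
    "\<And>a b. a \<in> R \<Longrightarrow> b \<in> R \<Longrightarrow> adjacent a b \<Longrightarrow> level b = level a + 1 \<Longrightarrow>
      h b = h a + of_bool (level b = m \<and> 2 * fst b < 2 * fst g + (m - level g))"
proof -
  obtain h where h: "\<And>a b. a \<in> R \<Longrightarrow> b \<in> R \<Longrightarrow> adjacent a b \<Longrightarrow> h b = h a + crossing g a b"
    using potential_exists[OF R g] by blast
  have up: "h b = h a + of_bool (level b = level g \<and> fst b < fst g)"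
    if "a \<in> R" "b \<in> R" "adjacent a b" "level b = level a + 1" for a b
    using h[OF that(1-3)] that(4) by (simp add: crossing_def up_left_def)
  show ?thesis
  proof (cases "level g = m")
    case True
    then show ?thesis using up by (intro that[of h]) auto
  next
    case False
    then have m: "level g = m - 1" using m by simp
    show ?thesis
    proof (rule that[of "\<lambda>s. h s - of_bool (level s = m - 1 \<and> fst s < fst g)"])
      fix a b assume ab: "a \<in> R" "b \<in> R" "adjacent a b" "level b = level a + 1"
      have ne: "a \<noteq> g" using ab g by auto
      have "fst a \<noteq> fst g" if "level a = m - 1"
        using ne that m by (auto simp: level_def prod_eq_iff)
      then show "h b - of_bool (level b = m - 1 \<and> fst b < fst g) =
        h a - of_bool (level a = m - 1 \<and> fst a < fst g) +
          of_bool (level b = m \<and> 2 * fst b < 2 * fst g + (m - level g))"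
        using up[OF ab] ab(4) adjacent_level[OF ab(3)] m by (auto simp: of_bool_def)
    qed
  qed
qed

lemma representative:
  assumes "n > 0" "a \<le> q" "q < a + int n"
  shows "int n dvd q - c \<longleftrightarrow> q = a + (c - a) mod int n"
proof
  assume "int n dvd q - c"
  then have "(q - a) mod int n = (c - a) mod int n"
    by (simp add: mod_eq_dvd_iff)
  moreover have "(q - a) mod int n = q - a" using assms by (intro mod_pos_pos_trivial) auto
  ultimately show "q = a + (c - a) mod int n" by simp
next
  assume "q = a + (c - a) mod int n"
  then have "(q - a) mod int n = (c - a) mod int n" by simp
  then show "int n dvd q - c" by (simp add: mod_eq_dvd_iff)
qed

lemma sum_color:
  assumes "n > 0"
  shows "(\<Sum>q\<in>{a..<a + int n}. if int n dvd q - c then F q else 0) = (F (a + (c - a) mod int n) :: int)"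
proof -
  have "(\<Sum>q\<in>{a..<a + int n}. if int n dvd q - c then F q else 0)
      = (\<Sum>q\<in>{a..<a + int n}. if q = a + (c - a) mod int n then F q else 0)"
    using representative[OF assms] by (intro sum.cong) auto
  moreover have "a + (c - a) mod int n \<in> {a..<a + int n}" using assms by simp
  ultimately show ?thesis by (simp add: sum.delta)
qed

text \<open>With \<open>h\<close> the potential that jumps by 1 across the part of the zigzag left of \<open>g\<close>, the sum
  of \<open>h\<close> over the squares of color \<open>l - 1\<close> minus its sum over the squares of color \<open>l\<close> is a sum of
  contributions of single tiles, and only tiles crossing the zigzag left of \<open>g\<close> contribute.\<close>
lemma gap_weight:
  assumes R: "simply_connected_region R" and g: "g \<notin> R" and m: "level g = m \<or> level g = m - 1"
    and l: "m - int n \<le> l" "l \<le> m"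
  obtains f :: "square \<Rightarrow> int" where
    "\<And>t P i. labelled n R t P \<Longrightarrow> i \<in> index t \<Longrightarrow>
      (\<Sum>q\<in>{fst i..<fst i + int n}. f (cell P i q)) =
        of_bool (fst i = l \<and> zig n P i m < 2 * fst g + (m - level g))"
proof -
  define zg where "zg = 2 * fst g + (m - level g)"
  obtain h :: "square \<Rightarrow> int" where
    h: "\<And>a b. a \<in> R \<Longrightarrow> b \<in> R \<Longrightarrow> adjacent a b \<Longrightarrow> level b = level a + 1 \<Longrightarrow>
      h b = h a + of_bool (level b = m \<and> 2 * fst b < zg)"
    unfolding zg_def using potential_on_zigzag[OF R g m] by blast
  define H where "H c s = (if int n dvd level s - c then h s else 0)" for c s
  \<comment> \<open>For \<open>l = m\<close> and \<open>l = m - int n\<close> the two color classes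
    are those of the zigzag levels, so each tile crossing left of \<open>g\<close> would contribute
    -1. The two extra terms cancel this and count the tiles that start on \<open>m\<close> or end on
    \<open>m - 1\<close>.\<close>
  define f where "f s = H (l - 1) s - H l s + of_bool (level s = m \<and> l = m \<and> 2 * fst s < zg)
     + of_bool (level s = m - 1 \<and> l = m - int n \<and> 2 * fst s + 1 < zg)" for s
  have "(\<Sum>q\<in>{fst i..<fst i + int n}. f (cell P i q)) = of_bool (fst i = l \<and> zig n P i m < zg)"
    if lab: "labelled n R t P" and i: "i \<in> index t" for t P i
  proof -
    interpret labelled n R t P by (fact lab)
    define a where "a = fst i"
    define J :: int where "J = of_bool (a < m \<and> m < a + int n \<and> 2 * P i m < zg)"
    define rep where "rep c = a + (c - a) mod int n" for c
    have hq: "h (cell P i q) = h (cell P i a) + (if m \<le> q then J else 0)"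
      if "a \<le> q" "q < a + int n" for q
      using that
    proof (induction q rule: int_ge_induct)
      case base
      then show ?case by (simp add: J_def)
    next
      case (step q)
      have "adjacent (cell P i q) (cell P i (q + 1))"
        using labelled.step[OF lab i, of q] step by (auto simp: adjacent_iff_level a_def)
      then have "h (cell P i (q + 1)) = h (cell P i q) + of_bool (q + 1 = m \<and> 2 * P i (q + 1) < zg)"
        using h[of "cell P i q" "cell P i (q + 1)"] cell_in_R[OF i] step by (simp add: a_def)
      then show ?case using step by (cases "q + 1 = m") (auto simp: J_def)
    qed
    have rep_range: "a \<le> rep c" "rep c < a + int n" for c
      using n_pos by (simp_all add: rep_def)
    have repI: "rep c = q" if "a \<le> q" "q < a + int n" "int n dvd q - c" for c q
      using representative[OF n_pos that(1,2), of c] that(3) by (simp add: rep_def)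
    have H: "(\<Sum>q\<in>{a..<a + int n}. H c (cell P i q)) = h (cell P i a) + (if m \<le> rep c then J else 0)"
      for c
      unfolding H_def level_cell sum_color[OF n_pos]
      using hq[OF rep_range] by (simp add: rep_def)
    have "(\<Sum>q\<in>{a..<a + int n}. f (cell P i q)) =
      (if m \<le> rep (l - 1) then J else 0) - (if m \<le> rep l then J else 0)
       + of_bool (m \<in> {a..<a + int n} \<and> l = m \<and> 2 * P i m < zg)
       + of_bool (m - 1 \<in> {a..<a + int n} \<and> l = m - int n \<and> 2 * P i (m - 1) + 1 < zg)"
      unfolding f_def sum.distrib sum_subtractf H level_cell fst_cell
      by (simp only: sum_of_bool_eq[OF finite_atLeastLessThan_int])
    also have "\<dots> = of_bool (a = l \<and> zig n P i m < zg)"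
    proof (cases "a < m \<and> m < a + int n")
      case False
      then have "J = 0" by (auto simp: J_def)
      then show ?thesis using False l n_pos by (auto simp: zig_def a_def)
    next
      case True
      have zJ: "J = of_bool (zig n P i m < zg)" using True by (simp add: J_def zig_def a_def)
      consider "l = m" | "l = m - int n" | "m - int n < l" "l < m" using l by linarith
      then show ?thesis
      proof cases
        case 1
        have "rep m = m" "rep (m - 1) = m - 1" using True by (auto intro!: repI)
        then show ?thesis using 1 True n_pos by (auto simp: zJ zig_def a_def)
      next
        case 2
        have "rep l = m" "rep (l - 1) = m - 1" using True 2 by (auto intro!: repI)
        \<comment> \<open>The two squares are neighbours on the zigzag and \<open>g\<close> is
          neither of them, so it cannot separate them.\<close>
        moreover have "2 * P i (m - 1) + 1 < zg \<longleftrightarrow> 2 * P i m < zg"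
        proof -
          have "cell P i m \<in> R" "cell P i (m - 1) \<in> R"
            using True by (auto intro!: cell_in_R[OF i] simp: a_def)
          then have "g \<noteq> cell P i m" "g \<noteq> cell P i (m - 1)" using g by auto
          then have "zg \<noteq> 2 * P i m" "zg \<noteq> 2 * P i (m - 1) + 1"
            using m unfolding eq_cell_iff zg_def by (auto; presburger)+
          then show ?thesis
            using labelled.step[OF lab i, of "m - 1"] True by (auto simp: a_def)
        qed
        ultimately show ?thesis using 2 True n_pos by (auto simp: zJ zig_def a_def)
      next
        case 3
        \<comment> \<open>The two representatives lie on opposite sides of the jump only if
          \<open>a = l\<close>, where the tile begins with color \<open>l\<close> and ends with
          color \<open>l - 1\<close>.\<close>
        have "rep l = l" if "a \<le> l" using that True 3 by (auto intro!: repI)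
        moreover have "rep (l - 1) = l - 1" if "a < l" using that True 3 by (auto intro!: repI)
        moreover have "rep l = l + int n" if "l < a" using that True 3 by (auto intro!: repI)
        moreover have "rep (l - 1) = l - 1 + int n" if "l \<le> a" using that True 3 by (auto intro!: repI)
        ultimately show ?thesis using 3 by (cases l a rule: linorder_cases) (auto simp: zJ)
      qed
    qed
    finally show ?thesis by (simp add: a_def)
  qed
  then show ?thesis using that unfolding zg_def by blast
qed

locale labelled_pair = P: labelled n R t P + Q: labelled n R t Q
  for n R t P Q +
  assumes simply: "simply_connected_region R"
begin

text \<open>By \<open>gap_weight\<close>, the number of tiles with the start level of
  \<open>i\<close> left of \<open>g\<close> is a sum over \<open>R\<close>, hence equal for
  \<open>P\<close> and \<open>Q\<close>. These tiles form an initial segment of labels, so they are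
  the same ones.\<close>

lemma gap_side:
  assumes i: "i \<in> index t" "meets n i m"
    and g: "g \<notin> R" "level g = m \<or> level g = m - 1"
    and less: "zig n P i m < 2 * fst g + (m - level g)"
  shows "zig n Q i m < 2 * fst g + (m - level g)"
proof -
  define l where "l = fst i"
  define zg where "zg = 2 * fst g + (m - level g)"
  have l: "m - int n \<le> l" "l \<le> m" using i by (auto simp: meets_def l_def)
  obtain f :: "square \<Rightarrow> int" where
    f: "\<And>t P i. labelled n R t P \<Longrightarrow> i \<in> index t \<Longrightarrow>
      (\<Sum>q\<in>{fst i..<fst i + int n}. f (cell P i q)) = of_bool (fst i = l \<and> zig n P i m < zg)"
    unfolding zg_def using gap_weight[OF simply g l] by blast
  have card: "int (card {k. k < t l \<and> zig n P' (l, k) m < zg}) = (\<Sum>s\<in>R. f s)"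
    if "labelled n R t P'" for P'
  proof -
    interpret labelled n R t P' by fact
    show ?thesis
      unfolding sum_R sum_index_card[of l "\<lambda>i. zig n P' i m < zg", symmetric]
      using f[OF that] by (intro sum.cong) auto
  qed
  have meets: "meets n (l, 0) m" using i by (simp add: meets_def l_def)
  have "{k. k < t l \<and> zig n P (l, k) m < zg} = {k. k < t l \<and> zig n Q (l, k) m < zg}"
    using card[OF P.labelled_axioms] card[OF Q.labelled_axioms]
    by (intro initial_segment_eqI[OF P.zig_less_set[OF meets] Q.zig_less_set[OF meets]]) simp
  then have "snd i \<in> {k. k < t l \<and> zig n P (l, k) m < zg}
    \<longleftrightarrow> snd i \<in> {k. k < t l \<and> zig n Q (l, k) m < zg}" by simp
  moreover have "snd i < t l" using i by (simp add: index_def l_def)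
  moreover have "(l, snd i) = i" by (simp add: l_def)
  ultimately show ?thesis using less by (simp add: zg_def)
qed

end

lemma labelled_pair_swap: "labelled_pair n R t P Q \<Longrightarrow> labelled_pair n R t Q P"
  by (simp add: labelled_pair_def)

text \<open>If a tile starts at the square of level \<open>m\<close> in column \<open>x\<close>, every tile crossing the zigzag has
  its two squares on the same side of it and cancels in this sum, which thus counts the starting minus
  the ending tiles to the left.\<close>
definition balance :: "square set \<Rightarrow> int \<Rightarrow> int \<Rightarrow> int" where
  "balance R m x =
    (\<Sum>s\<in>R. of_bool (level s = m \<and> fst s < x) - of_bool (level s = m - 1 \<and> fst s < x))"

text \<open>The tiles starting on \<open>m\<close> to the left of \<open>i\<close> are those with
  smaller labels. As \<open>balance\<close> depends only on the region and the column, the number of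
  tiles ending just below to the left can be recovered from it.\<close>

lemma (in labelled) balance_start:
  assumes i: "i \<in> index t" "fst i = m"
  shows "balance R m (P i m)
    = int (snd i) - int (card {k. k < t (m - int n) \<and> z (m - int n, k) m < z i m})"
proof -
  define x where "x = P i m"
  have zi: "z i m = 2 * x" using i n_pos by (simp add: zig_def x_def)
  have tile_sum: "(\<Sum>q\<in>{fst j..<fst j + int n}. of_bool (level (cell P j q) = m \<and> fst (cell P j q) < x)
       - of_bool (level (cell P j q) = m - 1 \<and> fst (cell P j q) < x))
     = (of_bool (fst j = m \<and> z j m < z i m) - of_bool (fst j = m - int n \<and> z j m < z i m) :: int)"
    if j: "j \<in> index t" for j
  proof -
    \<comment> \<open>Column \<open>x\<close> of level \<open>m\<close> is taken by
      \<open>i\<close>, so \<open>j\<close> avoids it there, and a step adding 0 or 1 to the column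
      cannot get past it.\<close>
    have cross: "P j m < x \<longleftrightarrow> P j (m - 1) < x" if m: "fst j < m" "m < fst j + int n"
    proof -
      have "j \<noteq> i" using m i by auto
      then have "P j m \<noteq> x" using inj[of j m i] i j m by (auto simp: x_def)
      then show ?thesis using step[OF j, of "m - 1"] m by auto
    qed
    have "(\<Sum>q\<in>{fst j..<fst j + int n}. of_bool (level (cell P j q) = m \<and> fst (cell P j q) < x)
       - of_bool (level (cell P j q) = m - 1 \<and> fst (cell P j q) < x))
      = (of_bool (m \<in> {fst j..<fst j + int n} \<and> P j m < x)
       - of_bool (m - 1 \<in> {fst j..<fst j + int n} \<and> P j (m - 1) < x) :: int)"
      unfolding sum_subtractf level_cell fst_cell
      by (simp only: sum_of_bool_eq[OF finite_atLeastLessThan_int])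
    also have "\<dots> = of_bool (fst j = m \<and> z j m < z i m) - of_bool (fst j = m - int n \<and> z j m < z i m)"
    proof (cases "fst j < m \<and> m < fst j + int n")
      case True
      then show ?thesis using cross by auto
    next
      case False
      then consider "fst j = m" | "m = fst j + int n" | "m < fst j" | "fst j + int n < m" by linarith
      then show ?thesis unfolding zi using n_pos by cases (auto simp: zig_def)
    qed
    finally show ?thesis .
  qed
  have "{k. k < t m \<and> z (m, k) m < z i m} = {..<snd i}"
  proof (intro set_eqI iffI)
    fix k assume k: "k \<in> {k. k < t m \<and> z (m, k) m < z i m}"
    have "\<not> snd i < k"
    proof
      assume "snd i < k"
      then have "z (m, snd i) m < z (m, k) m"
        using k by (intro zig_mono_label) (auto simp: meets_def)
      then show False using k i by auto
    qed
    moreover have "snd i \<noteq> k" using k i by auto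
    ultimately show "k \<in> {..<snd i}" by simp
  next
    fix k assume k: "k \<in> {..<snd i}"
    then have "z (m, k) m < z (m, snd i) m"
      using i by (intro zig_mono_label) (auto simp: meets_def index_def)
    then show "k \<in> {k. k < t m \<and> z (m, k) m < z i m}" using k i by (auto simp: index_def)
  qed
  then have card: "int (card {k. k < t m \<and> z (m, k) m < z i m}) = int (snd i)" by simp
  have "balance R m x = (\<Sum>j\<in>index t. of_bool (fst j = m \<and> z j m < z i m)
       - of_bool (fst j = m - int n \<and> z j m < z i m))"
    unfolding balance_def sum_R by (intro sum.cong refl tile_sum)
  also have "\<dots> = int (snd i) - int (card {k. k < t (m - int n) \<and> z (m - int n, k) m < z i m})"
    unfolding sum_subtractf sum_index_card[where Q = "\<lambda>j. z j m < z i m"] card ..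
  finally show ?thesis by (simp add: x_def)
qed

text \<open>Moving the bound by one column adds one square on each of the two levels, with opposite
  signs.\<close>

lemma balance_step:
  assumes "finite R" "(y, m - y) \<in> R" "(y, m - 1 - y) \<in> R"
  shows "balance R m (y + 1) = balance R m y"
proof -
  have "balance R m (y + 1) - balance R m y
    = (\<Sum>s\<in>R. of_bool (s = (y, m - y) \<and> True) - of_bool (s = (y, m - 1 - y) \<and> True))"
    unfolding balance_def sum_subtractf[symmetric]
    by (intro sum.cong) (auto simp: level_def of_bool_def prod_eq_iff)
  also have "\<dots> = 0" unfolding sum_subtractf sum_of_bool_eq[OF assms(1)] using assms by simp
  finally show ?thesis by simp
qed

context labelled_pair
begin

text \<open>The zigzag squares between the two positions of \<open>i\<close> all belong to
  \<open>R\<close>: a missing one would be passed on different sides in \<open>P\<close> and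
  \<open>Q\<close>, against \<open>gap_side\<close>. So \<open>balance_step\<close> applies all the
  way.\<close>

lemma balance_eq_le:
  assumes i: "i \<in> index t" "fst i = m" and le: "P i m \<le> Q i m"
  shows "balance R m (Q i m) = balance R m (P i m)"
proof -
  have z: "zig n P i m = 2 * P i m" "zig n Q i m = 2 * Q i m"
    using i P.n_pos by (simp_all add: zig_def)
  have meets: "meets n i m" using i by (simp add: meets_def)
  have "balance R m y = balance R m (P i m)" if "P i m \<le> y" "y \<le> Q i m" for y
    using that
  proof (induction y rule: int_ge_induct)
    case (step y)
    have "(y, m - y) \<in> R"
    proof (cases "y = P i m")
      case True
      then show ?thesis using P.cell_in_R[of i m] i P.n_pos by (simp add: cell_def)
    next
      case False
      show ?thesis
      proof (rule ccontr)
        assume "(y, m - y) \<notin> R"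
        from gap_side[OF i(1) meets this] show False
          using z step False by (simp add: level_def)
      qed
    qed
    moreover have "(y, m - 1 - y) \<in> R"
    proof (rule ccontr)
      assume "(y, m - 1 - y) \<notin> R"
      from gap_side[OF i(1) meets this] show False
        using z step by (simp add: level_def)
    qed
    ultimately have "balance R m (y + 1) = balance R m y"
      by (rule balance_step[OF P.finite_R])
    then show ?case using step by simp
  qed simp
  from this[OF le order_refl] show ?thesis .
qed

lemma balance_eq:
  assumes i: "i \<in> index t" "fst i = m"
  shows "balance R m (Q i m) = balance R m (P i m)"
proof (cases "P i m \<le> Q i m")
  case False
  interpret swap: labelled_pair n R t Q P using labelled_pair_swap labelled_pair_axioms .
  show ?thesis using swap.balance_eq_le[OF i] False by simp
qed (use balance_eq_le i in blast)

text \<open>By \<open>balance_start\<close>, equal balances and equal labels give the same number of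
  ending tiles left of \<open>i\<close>, hence the same tiles, as they form an initial segment of
  labels.\<close>

lemma forced_order:
  assumes i: "i \<in> index t" "fst i = m" and j: "j \<in> index t" "fst j = m - int n"
  shows "zig n P j m < zig n P i m \<longleftrightarrow> zig n Q j m < zig n Q i m"
proof -
  have card: "int (card {k. k < t (m - int n) \<and> zig n P (m - int n, k) m < zig n P i m})
    = int (card {k. k < t (m - int n) \<and> zig n Q (m - int n, k) m < zig n Q i m})"
    using P.balance_start[OF i] Q.balance_start[OF i] balance_eq[OF i] by simp
  have meets: "meets n (m - int n, 0) m" by (simp add: meets_def)
  have "{k. k < t (m - int n) \<and> zig n P (m - int n, k) m < zig n P i m}
    = {k. k < t (m - int n) \<and> zig n Q (m - int n, k) m < zig n Q i m}"
    by (rule initial_segment_eqI[OF P.zig_less_set[OF meets] Q.zig_less_set[OF meets] card])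
  then have "snd j \<in> {k. k < t (m - int n) \<and> zig n P (m - int n, k) m < zig n P i m}
    \<longleftrightarrow> snd j \<in> {k. k < t (m - int n) \<and> zig n Q (m - int n, k) m < zig n Q i m}" by simp
  moreover have "snd j < t (m - int n)" using j by (simp add: index_def)
  ultimately have "zig n P (m - int n, snd j) m < zig n P i m
    \<longleftrightarrow> zig n Q (m - int n, snd j) m < zig n Q i m"
    by simp
  moreover have "(m - int n, snd j) = j" using j by (simp add: prod_eq_iff)
  ultimately show ?thesis by simp
qed

end

section \<open>The order of the tiles\<close>

text \<open>A relation that is transitive only on triples of pairwise comparable elements is still acyclic
  when comparability means a level difference of at most \<open>n\<close>: the two neighbours of an element of
  lowest level are comparable.\<close>
lemma ex_minimal_of_levels:
  fixes lev :: "'a \<Rightarrow> int"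
  assumes "finite A" "A \<noteq> {}"
    and near: "\<And>x y. (x, y) \<in> r \<Longrightarrow> \<bar>lev x - lev y\<bar> \<le> d"
    and asym: "\<And>x y. (x, y) \<in> r \<Longrightarrow> (y, x) \<notin> r"
    and trans: "\<And>x y z. (x, y) \<in> r \<Longrightarrow> (y, z) \<in> r \<Longrightarrow> \<bar>lev x - lev z\<bar> \<le> d \<Longrightarrow> (x, z) \<in> r"
  shows "\<exists>x\<in>A. \<forall>y\<in>A. (y, x) \<notin> r"
  using assms(1,2)
proof (induction A rule: finite_psubset_induct)
  case (psubset A)
  have "Min (lev ` A) \<in> lev ` A" using psubset by simp
  then obtain a where a: "a \<in> A" "lev a = Min (lev ` A)" by auto
  then have low: "lev a \<le> lev y" if "y \<in> A" for y using psubset.hyps that by simp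
  show ?case
  proof (cases "A = {a}")
    case True
    then show ?thesis using asym by auto
  next
    case False
    then have "A - {a} \<subset> A" "A - {a} \<noteq> {}" using a by auto
    \<comment> \<open>A minimal element of the rest can fail to be minimal in \<open>A\<close> only
      because of \<open>a\<close>; in that case \<open>a\<close> itself is minimal.\<close>
    then obtain x where x: "x \<in> A - {a}" "\<And>y. y \<in> A - {a} \<Longrightarrow> (y, x) \<notin> r"
      using psubset.IH by metis
    show ?thesis
    proof (cases "(a, x) \<in> r")
      case True
      have "(y, a) \<notin> r" if y: "y \<in> A" for y
      proof
        assume ya: "(y, a) \<in> r"
        have "\<bar>lev y - lev x\<bar> \<le> d"
          using near[OF ya] near[OF True] low[OF y] low[of x] x(1) by auto
        then have "(y, x) \<in> r" using trans ya True by blast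
        moreover have "y \<noteq> a" using ya asym by auto
        ultimately show False using x(2) y by auto
      qed
      then show ?thesis using a by auto
    next
      case False
      then show ?thesis using x by auto
    qed
  qed
qed

text \<open>The maximum of the start levels is the lowest level whose zigzag meets both tiles; by
  \<open>zig_less\<close> any other common zigzag gives the same order.\<close>

definition before :: "nat \<Rightarrow> (int \<Rightarrow> nat) \<Rightarrow> (int \<times> nat \<Rightarrow> int \<Rightarrow> int) \<Rightarrow> (int \<times> nat) rel" where
  "before n t P = {(i, j). i \<in> index t \<and> j \<in> index t \<and> \<bar>fst i - fst j\<bar> \<le> int n \<and>
     zig n P i (max (fst i) (fst j)) < zig n P j (max (fst i) (fst j))}"

lemma mem_tile_iff: "s \<in> tile n P i \<longleftrightarrow> fst i \<le> level s \<and> level s < fst i + int n \<and> fst s = P i (level s)"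
  unfolding tile_def by (auto simp: image_iff eq_cell_iff)

context labelled
begin

lemma before_iff:
  assumes "i \<in> index t" "j \<in> index t" "meets n i m" "meets n j m"
  shows "(i, j) \<in> before n t P \<longleftrightarrow> z i m < z j m"
proof -
  have "meets n i (max (fst i) (fst j))" "meets n j (max (fst i) (fst j))" "\<bar>fst i - fst j\<bar> \<le> int n"
    using assms by (auto simp: meets_def)
  then show ?thesis
    using zig_less[of i j m "max (fst i) (fst j)"] zig_less[of i j "max (fst i) (fst j)" m] assms
    by (auto simp: before_def)
qed

lemma before_iff_same_level:
  assumes "i \<in> index t" "fst i \<le> m" "m < fst i + int n" "j \<in> index t" "fst j \<le> m" "m < fst j + int n"
  shows "(i, j) \<in> before n t P \<longleftrightarrow> P i m < P j m"
  using before_iff[of i j m] assms by (simp add: meets_def zig_def)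

lemma before_asym: "(i, j) \<in> before n t P \<Longrightarrow> (j, i) \<notin> before n t P"
  by (auto simp: before_def max.commute)

lemma before_total:
  assumes "i \<in> index t" "j \<in> index t" "i \<noteq> j" "\<bar>fst i - fst j\<bar> \<le> int n"
  shows "(i, j) \<in> before n t P \<or> (j, i) \<in> before n t P"
proof -
  let ?m = "max (fst i) (fst j)"
  have m: "meets n i ?m" "meets n j ?m" using assms(4) by (auto simp: meets_def)
  then have "z i ?m \<noteq> z j ?m" using zig_inj assms by blast
  then show ?thesis using before_iff[of i j ?m] before_iff[of j i ?m] assms m by auto
qed

text \<open>Three pairwise comparable tiles all meet the zigzag at the highest of their start
  levels, where the order is that of the integers. The bound on \<open>i\<close> and
  \<open>k\<close> provides this common zigzag.\<close>

lemma before_trans: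
  assumes ij: "(i, j) \<in> before n t P" and jk: "(j, k) \<in> before n t P"
    and ik: "\<bar>fst i - fst k\<bar> \<le> int n"
  shows "(i, k) \<in> before n t P"
proof -
  define m where "m = max (max (fst i) (fst j)) (fst k)"
  have idx: "i \<in> index t" "j \<in> index t" "k \<in> index t"
    and near: "\<bar>fst i - fst j\<bar> \<le> int n" "\<bar>fst j - fst k\<bar> \<le> int n"
    using ij jk by (auto simp: before_def)
  have "meets n i m" "meets n j m" "meets n k m"
    using near ik by (auto simp: meets_def m_def)
  then show ?thesis
    using before_iff[of i j m] before_iff[of j k m] before_iff[of i k m] idx ij jk by simp
qed

lemma before_near: "(i, j) \<in> before n t P \<Longrightarrow> \<bar>fst i - fst j\<bar> \<le> int n"
  by (simp add: before_def)

lemma before_same_start: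
  assumes "i \<in> index t" "j \<in> index t" "fst i = fst j"
  shows "(i, j) \<in> before n t P \<longleftrightarrow> snd i < snd j"
proof -
  obtain l p q where [simp]: "i = (l, p)" "j = (l, q)" using assms(3) by (cases i; cases j) auto
  have "P i (fst i) < P j (fst i) \<longleftrightarrow> snd i < snd j"
    using sorted[of p q l] sorted[of q p l] assms(1,2)
    by (cases p q rule: linorder_cases) (auto simp: index_def)
  then show ?thesis
    using before_iff_same_level[of i "fst i" j] assms n_pos by simp
qed

lemma before_minimal:
  assumes "A \<subseteq> index t" "A \<noteq> {}"
  shows "\<exists>x\<in>A. \<forall>y\<in>A. (y, x) \<notin> before n t P"
  using finite_subset[OF assms(1) finite_index] assms(2) before_near before_asym before_trans
  by (rule ex_minimal_of_levels)

lemma before_maximal: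
  assumes "A \<subseteq> index t" "A \<noteq> {}"
  shows "\<exists>x\<in>A. \<forall>y\<in>A. (x, y) \<notin> before n t P"
proof -
  have "\<exists>x\<in>A. \<forall>y\<in>A. (y, x) \<notin> (before n t P)\<inverse>"
    using finite_subset[OF assms(1) finite_index] assms(2)
  proof (rule ex_minimal_of_levels)
    show "\<bar>fst x - fst y\<bar> \<le> int n" if "(x, y) \<in> (before n t P)\<inverse>" for x y
      using before_near[of y x] that by auto
    show "(y, x) \<notin> (before n t P)\<inverse>" if "(x, y) \<in> (before n t P)\<inverse>" for x y
      using before_asym[of y x] that by auto
    show "(x, z) \<in> (before n t P)\<inverse>"
      if "(x, y) \<in> (before n t P)\<inverse>" "(y, z) \<in> (before n t P)\<inverse>" "\<bar>fst x - fst z\<bar> \<le> int n" for x y z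
      using before_trans[of z y x] that by auto
  qed
  then show ?thesis by simp
qed

lemma tile_eq_iff:
  assumes "i \<in> index t" "j \<in> index t"
  shows "tile n P i = tile n P j \<longleftrightarrow> i = j"
proof
  assume eq: "tile n P i = tile n P j"
  have "cell P i (fst i) \<in> tile n P i" using n_pos by (simp add: mem_tile_iff)
  then have "cell P i (fst i) \<in> tile n P j" using eq by simp
  then show "i = j" using inj[of i "fst i" j] assms n_pos by (simp add: mem_tile_iff)
qed simp

end

section \<open>Exchanging the parts of two tiles\<close>

text \<open>The swapped levels are those common to both tiles when \<open>a\<close> starts first.
  Tile \<open>a\<close> keeps its beginning and \<open>b\<close> its end, so both keep their level
  ranges and labels.\<close>

definition exchange :: "nat \<Rightarrow> (int \<times> nat \<Rightarrow> int \<Rightarrow> int) \<Rightarrow> int \<times> nat \<Rightarrow> int \<times> nat \<Rightarrow>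
    int \<times> nat \<Rightarrow> int \<Rightarrow> int" where
  "exchange n P a b k q =
    (if fst b \<le> q \<and> q < fst a + int n then P (Transposition.transpose a b k) q else P k q)"

text \<open>\<open>bottom\<close> lets tile \<open>a\<close> continue onto the squares of
  \<open>b\<close>, and \<open>top\<close> lets the rest of \<open>b\<close> continue from the last
  square of \<open>a\<close>. It stays open which of the two is on the left, so one locale serves
  both kinds of inversion.\<close>

locale exchangeable = labelled +
  fixes a b :: "int \<times> nat"
  assumes ab: "a \<in> index t" "b \<in> index t" "fst a < fst b" "fst b < fst a + int n"
    and beside: "\<And>q. fst b \<le> q \<Longrightarrow> q < fst a + int n \<Longrightarrow> \<bar>P a q - P b q\<bar> = 1"
    and bottom: "P b (fst b) = P a (fst b - 1) \<or> P b (fst b) = P a (fst b - 1) + 1"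
    and top: "P b (fst a + int n) = P a (fst a + int n - 1) \<or>
      P b (fst a + int n) = P a (fst a + int n - 1) + 1"
begin

abbreviation "P' \<equiv> exchange n P a b"

lemma ab_ne: "a \<noteq> b" using ab by auto

lemma exchange_simps:
  "fst b \<le> q \<Longrightarrow> q < fst a + int n \<Longrightarrow> P' a q = P b q"
  "fst b \<le> q \<Longrightarrow> q < fst a + int n \<Longrightarrow> P' b q = P a q"
  "\<not> (fst b \<le> q \<and> q < fst a + int n) \<Longrightarrow> P' k q = P k q"
  "k \<noteq> a \<Longrightarrow> k \<noteq> b \<Longrightarrow> P' k q = P k q"
  by (auto simp: exchange_def)

lemma exchange_step:
  assumes k: "k \<in> index t" "fst k \<le> m" "m + 1 < fst k + int n"
  shows "P' k (m + 1) = P' k m \<or> P' k (m + 1) = P' k m + 1"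
proof -
  consider "k \<noteq> a" "k \<noteq> b" | "k = a" | "k = b" by blast
  then show ?thesis
  proof cases
    case 1
    then show ?thesis using step[OF k] by (simp add: exchange_simps)
  next
    case 2
    consider "m + 1 < fst b" | "m + 1 = fst b" | "fst b \<le> m" by linarith
    then show ?thesis
    proof cases
      case 1
      then show ?thesis using step[OF k] by (simp add: exchange_simps)
    next
      case m: 2
      then have "m = fst b - 1" by simp
      then show ?thesis using bottom ab 2 by (simp add: exchange_simps)
    next
      case 3
      then show ?thesis using step[OF ab(2), of m] ab 2 k by (simp add: exchange_simps)
    qed
  next
    case 3
    consider "m + 1 < fst a + int n" | "m + 1 = fst a + int n" | "fst a + int n \<le> m" by linarith
    then show ?thesis
    proof cases
      case 1
      then show ?thesis using step[OF ab(1), of m] ab 3 k by (simp add: exchange_simps)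
    next
      case m: 2
      then have "m = fst a + int n - 1" by simp
      then show ?thesis using top ab 3 k by (simp add: exchange_simps)
    next
      case m: 3
      then show ?thesis using step[OF k] by (simp add: exchange_simps)
    qed
  qed
qed

text \<open>Among the tiles starting on a level, only \<open>b\<close> can change its column there;
  it moves by one column onto a square of \<open>a\<close> and so passes no other tile.\<close>

lemma exchange_sorted:
  assumes "j < k" "k < t l"
  shows "P' (l, j) l < P' (l, k) l"
proof (cases "fst b \<le> l \<and> l < fst a + int n")
  case False
  then show ?thesis using sorted[OF assms] by (simp only: exchange_simps(3)[OF False])
next
  case True
  have less: "P (l, j) l < P (l, k) l" using sorted[OF assms] .
  have idx: "(l, j) \<in> index t" "(l, k) \<in> index t" using assms by (auto simp: index_def)
  have ne: "(l, j) \<noteq> a" "(l, k) \<noteq> a" using True ab by auto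
  consider "(l, j) = b" | "(l, k) = b" | "(l, j) \<noteq> b" "(l, k) \<noteq> b" by blast
  then show ?thesis
  proof cases
    case 1
    then have kb: "(l, k) \<noteq> b" using assms by auto
    have "P (l, k) l \<noteq> P a l" using inj[of "(l, k)" l a] idx ab ne True by auto
    then have "P a l < P (l, k) l" using beside[of l] True less 1 by auto
    then show ?thesis using 1 kb ne True by (simp add: exchange_simps)
  next
    case 2
    then have jb: "(l, j) \<noteq> b" using assms by auto
    have "P (l, j) l \<noteq> P a l" using inj[of "(l, j)" l a] idx ab ne True by auto
    then have "P (l, j) l < P a l" using beside[of l] True less 2 by auto
    then show ?thesis using 2 jb ne True by (simp add: exchange_simps)
  next
    case 3
    then show ?thesis using less ne by (simp add: exchange_simps)
  qed
qed

lemma labelled_exchange: "labelled n R t P'"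
proof
  show "n > 0" "finite R" by (fact n_pos finite_R)+
  show "P' k (m + 1) = P' k m \<or> P' k (m + 1) = P' k m + 1"
    if "k \<in> index t" "fst k \<le> m" "m + 1 < fst k + int n" for k m
    using exchange_step that .
  show "P' (l, j) l < P' (l, k) l" if "j < k" "k < t l" for l j k
    using exchange_sorted that .
  \<comment> \<open>The exchange only relabels squares: the new cell map is the old one composed
    with this involution.\<close>
  define \<sigma> where "\<sigma> = (\<lambda>(k, q). (if fst b \<le> q \<and> q < fst a + int n
      then Transposition.transpose a b k else k, q :: int))"
  have \<sigma>\<sigma>: "\<sigma> (\<sigma> x) = x" for x by (cases x) (auto simp: \<sigma>_def)
  have \<sigma>_cells: "\<sigma> x \<in> cells n t" if "x \<in> cells n t" for x
    using that ab by (cases x) (auto simp: \<sigma>_def cells_def Transposition.transpose_def)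
  have "bij_betw \<sigma> (cells n t) (cells n t)"
    using \<sigma>\<sigma> \<sigma>_cells by (intro bij_betw_byWitness[where f' = \<sigma>]) auto
  from bij_betw_trans[OF this bij]
  have "bij_betw ((\<lambda>(i, m). cell P i m) \<circ> \<sigma>) (cells n t) R" .
  also have "(\<lambda>(i, m). cell P i m) \<circ> \<sigma> = (\<lambda>(i, m). cell P' i m)"
    by (auto simp: \<sigma>_def cell_def exchange_def fun_eq_iff)
  finally show "bij_betw (\<lambda>(i, m). cell P' i m) (cells n t) R" .
qed

lemma local_move_exchange: "local_move n (tiles n t P) (tiles n t P')"
proof -
  interpret P': labelled n R t P' by (rule labelled_exchange)
  have un: "tile n P' a \<union> tile n P' b = tile n P a \<union> tile n P b"
  proof (rule set_eqI)
    fix s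
    show "s \<in> tile n P' a \<union> tile n P' b \<longleftrightarrow> s \<in> tile n P a \<union> tile n P b"
      using ab by (cases "fst b \<le> level s \<and> level s < fst a + int n")
        (auto simp: mem_tile_iff exchange_simps)
  qed
  \<comment> \<open>The first squares of both old tiles lie in the new tile \<open>a\<close>, but
    neither old tile contains both.\<close>
  have new: "tile n P' a \<notin> {tile n P a, tile n P b}"
  proof -
    have "cell P b (fst b) \<in> tile n P' a" using ab by (simp add: mem_tile_iff exchange_simps)
    moreover have "cell P b (fst b) \<notin> tile n P a"
      using beside[of "fst b"] ab by (auto simp: mem_tile_iff)
    moreover have "cell P a (fst a) \<in> tile n P' a" using ab n_pos by (simp add: mem_tile_iff exchange_simps)
    moreover have "cell P a (fst a) \<notin> tile n P b" using ab by (simp add: mem_tile_iff)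
    ultimately show ?thesis by auto
  qed
  have keep: "tile n P' k = tile n P k" if "k \<noteq> a" "k \<noteq> b" for k
    using that by (auto simp: mem_tile_iff exchange_simps)
  have "tiles n t P' = tile n P' ` (index t - {a, b}) \<union> {tile n P' a, tile n P' b}"
    unfolding tiles_def using ab by blast
  also have "tile n P' ` (index t - {a, b}) = tile n P ` (index t - {a, b})"
    using keep by (intro image_cong) simp_all
  also have "\<dots> = tiles n t P - {tile n P a, tile n P b}"
    unfolding tiles_def using ab tile_eq_iff by blast
  finally have eq: "tiles n t P' = (tiles n t P - {tile n P a, tile n P b}) \<union> {tile n P' a, tile n P' b}" .
  have mem: "tile n P a \<in> tiles n t P" "tile n P b \<in> tiles n t P"
    using ab by (simp_all add: tiles_def)
  have diff: "tile n P a \<noteq> tile n P b" "tile n P' a \<noteq> tile n P' b"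
    using ab ab_ne tile_eq_iff P'.tile_eq_iff by blast+
  have rib: "ribbon_tile n (tile n P' a)" "ribbon_tile n (tile n P' b)"
    using ab P'.ribbon_tile_tile by blast+
  have pair: "{tile n P' a, tile n P' b} \<noteq> {tile n P a, tile n P b}"
    using new by blast
  show ?thesis
    unfolding local_move_def by (intro exI conjI) (fact mem diff rib pair un eq)+
qed

text \<open>On common levels \<open>a\<close> and \<open>b\<close> occupy neighbouring columns, so
  no third tile lies between them, and swapping these columns does not alter its order relative to
  either.\<close>

lemma before_exchange:
  assumes near: "\<bar>fst k - fst w\<bar> < int n" and ne: "{k, w} \<noteq> {a, b}"
    and less: "(k, w) \<in> before n t P'"
  shows "(k, w) \<in> before n t P"
proof -
  interpret P': labelled n R t P' by (rule labelled_exchange)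
  define m where "m = max (fst k) (fst w)"
  have idx: "k \<in> index t" "w \<in> index t" using less by (auto simp: before_def)
  have m: "fst k \<le> m" "m < fst k + int n" "fst w \<le> m" "m < fst w + int n"
    using near by (auto simp: m_def)
  have kw: "k \<noteq> w" using less P'.before_asym[of k w] by auto
  have less': "P' k m < P' w m" using P'.before_iff_same_level idx m less by blast
  have "P k m < P w m"
  proof (cases "fst b \<le> m \<and> m < fst a + int n")
    case False
    then show ?thesis using less' by (simp only: exchange_simps(3)[OF False])
  next
    case True
    have am: "fst a \<le> m" "m < fst b + int n" using True ab by auto
    have neq: "P k m \<noteq> P w m" using inj[of k m w] idx m kw by auto
    have 1: "P x m \<noteq> P a m" "P x m \<noteq> P b m" if "x \<in> {k, w}" "x \<noteq> a" "x \<noteq> b" for x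
      using inj[of x m a] inj[of x m b] idx m that ab True am by auto
    have bs: "\<bar>P a m - P b m\<bar> = 1" using beside True by blast
    consider "k = a" "w \<noteq> b" | "k = b" "w \<noteq> a" | "w = a" "k \<noteq> b" | "w = b" "k \<noteq> a"
      | "k \<noteq> a" "k \<noteq> b" "w \<noteq> a" "w \<noteq> b" using ne by blast
    then show ?thesis
    proof cases
      case 1
      then have "P b m < P w m" using less' kw True by (simp add: exchange_simps)
      then show ?thesis using bs neq unfolding 1(1) by linarith
    next
      case 2
      then have "P a m < P w m" using less' kw True by (simp add: exchange_simps)
      then show ?thesis using bs neq unfolding 2(1) by linarith
    next
      case 3
      then have "P k m < P b m" using less' kw True by (simp add: exchange_simps)
      then show ?thesis using bs neq unfolding 3(1) by linarith
    next
      case 4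
      then have "P k m < P a m" using less' kw True by (simp add: exchange_simps)
      then show ?thesis using bs neq unfolding 4(1) by linarith
    next
      case 5
      then show ?thesis using less' by (simp add: exchange_simps)
    qed
  qed
  then show ?thesis using before_iff_same_level idx m by blast
qed

lemma before_exchange_ab:
  "(a, b) \<in> before n t P' \<longleftrightarrow> (b, a) \<in> before n t P"
  "(b, a) \<in> before n t P' \<longleftrightarrow> (a, b) \<in> before n t P"
proof -
  interpret P': labelled n R t P' by (rule labelled_exchange)
  show "(a, b) \<in> before n t P' \<longleftrightarrow> (b, a) \<in> before n t P"
    using P'.before_iff_same_level[of a "fst b" b] before_iff_same_level[of b "fst b" a] ab n_pos
    by (simp add: exchange_simps)
  show "(b, a) \<in> before n t P' \<longleftrightarrow> (a, b) \<in> before n t P"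
    using P'.before_iff_same_level[of b "fst b" a] before_iff_same_level[of a "fst b" b] ab n_pos
    by (simp add: exchange_simps)
qed

end

section \<open>Minimal inversions\<close>

context labelled_pair
begin

definition inversions :: "(int \<times> nat) rel" where
  "inversions = {(i, j). (i, j) \<in> before n t P \<and> (j, i) \<in> before n t Q}"

lemma inversions_subset: "inversions \<subseteq> index t \<times> index t"
  by (auto simp: inversions_def before_def)

text \<open>Tiles with the same start level are ordered by label, and a difference of exactly
  \<open>n\<close> is settled by \<open>forced_order\<close>.\<close>

lemma inversion_levels:
  assumes "(i, j) \<in> inversions"
  shows "fst i \<noteq> fst j" and "\<bar>fst i - fst j\<bar> < int n"
proof -
  have P: "(i, j) \<in> before n t P" and Q: "(j, i) \<in> before n t Q"
    using assms by (auto simp: inversions_def)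
  have idx: "i \<in> index t" "j \<in> index t" and near: "\<bar>fst i - fst j\<bar> \<le> int n"
    using P by (auto simp: before_def)
  show "fst i \<noteq> fst j"
    using P.before_same_start Q.before_same_start idx P Q by fastforce
  have "\<bar>fst i - fst j\<bar> \<noteq> int n"
  proof
    assume "\<bar>fst i - fst j\<bar> = int n"
    then consider "fst j = fst i - int n" | "fst i = fst j - int n" by linarith
    then show False
    proof cases
      case 1
      have m: "meets n i (fst i)" "meets n j (fst i)" using 1 by (auto simp: meets_def)
      show False
        using forced_order[OF idx(1) refl idx(2) 1] P Q P.before_iff[OF idx m]
          Q.before_iff[OF idx(2,1) m(2,1)] by simp
    next
      case 2
      have m: "meets n i (fst j)" "meets n j (fst j)" using 2 by (auto simp: meets_def)
      show False
        using forced_order[OF idx(2) refl idx(1) 2] P Q P.before_iff[OF idx m]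
          Q.before_iff[OF idx(2,1) m(2,1)] by simp
    qed
  qed
  then show "\<bar>fst i - fst j\<bar> < int n" using near by simp
qed

text \<open>Take \<open>i\<close> maximal among the left members of inversions and \<open>j\<close>
  minimal among its partners. A tile between them would form no inversion with either, so
  transitivity would put \<open>i\<close> before \<open>j\<close> in \<open>Q\<close> too.\<close>

lemma minimal_inversion:
  assumes "inversions \<noteq> {}"
  obtains i j where "(i, j) \<in> inversions"
    "\<And>w. (i, w) \<in> before n t P \<Longrightarrow> (w, j) \<notin> before n t P"
proof -
  have "Domain inversions \<subseteq> index t" "Domain inversions \<noteq> {}"
    using inversions_subset assms by auto
  then obtain i where i: "i \<in> Domain inversions"
    and imax: "\<And>w. w \<in> Domain inversions \<Longrightarrow> (i, w) \<notin> before n t P"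
    using P.before_maximal[of "Domain inversions"] by blast
  have "inversions `` {i} \<subseteq> index t" "inversions `` {i} \<noteq> {}"
    using inversions_subset i by auto
  then obtain j where "j \<in> inversions `` {i}"
    and jmin: "\<And>w. w \<in> inversions `` {i} \<Longrightarrow> (w, j) \<notin> before n t P"
    using P.before_minimal[of "inversions `` {i}"] by blast
  then have ij: "(i, j) \<in> inversions" by simp
  have "(w, j) \<notin> before n t P" if iw: "(i, w) \<in> before n t P" for w
  proof
    assume wj: "(w, j) \<in> before n t P"
    have "(i, w) \<notin> inversions" using jmin[of w] wj by auto
    moreover have "(w, j) \<notin> inversions" using imax[of w] iw by auto
    ultimately have "(w, i) \<notin> before n t Q" "(j, w) \<notin> before n t Q"
      using iw wj by (auto simp: inversions_def)
    moreover have "i \<noteq> w" "w \<noteq> j" using iw wj P.before_asym by blast+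
    ultimately have "(i, w) \<in> before n t Q" "(w, j) \<in> before n t Q"
      using Q.before_total[of i w] Q.before_total[of w j] iw wj by (auto simp: before_def)
    moreover have "\<bar>fst i - fst j\<bar> \<le> int n" using inversion_levels[OF ij] by simp
    ultimately have "(i, j) \<in> before n t Q" by (rule Q.before_trans)
    then show False using Q.before_asym ij by (auto simp: inversions_def)
  qed
  with ij show ?thesis by (rule that)
qed

text \<open>A square missing from \<open>R\<close> between the tiles would, by
  \<open>gap_side\<close>, keep \<open>i\<close> left of \<open>j\<close> in \<open>Q\<close> as
  well. A third tile covering the square would itself lie between \<open>i\<close> and
  \<open>j\<close>, which \<open>none\<close> excludes.\<close>

lemma zigzag_between:
  assumes ij: "(i, j) \<in> inversions" "meets n i m" "meets n j m"
    and none: "\<And>w. (i, w) \<in> before n t P \<Longrightarrow> (w, j) \<notin> before n t P"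
    and s: "level s = m \<or> level s = m - 1"
      "zig n P i m < 2 * fst s + (m - level s)" "2 * fst s + (m - level s) < zig n P j m"
  shows "s \<in> tile n P i \<union> tile n P j"
proof -
  interpret swap: labelled_pair n R t Q P using labelled_pair_swap labelled_pair_axioms .
  have idx: "i \<in> index t" "j \<in> index t" using ij inversions_subset by auto
  have "s \<in> R"
  proof (rule ccontr)
    assume "s \<notin> R"
    have "zig n Q i m < 2 * fst s + (m - level s)"
      using gap_side[OF idx(1) ij(2) \<open>s \<notin> R\<close> s(1,2)] .
    moreover have "\<not> zig n Q j m < 2 * fst s + (m - level s)"
      using swap.gap_side[OF idx(2) ij(3) \<open>s \<notin> R\<close> s(1)] s(3) by auto
    ultimately have "(i, j) \<in> before n t Q" using Q.before_iff[OF idx ij(2,3)] by simp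
    then show False using Q.before_asym ij(1) by (auto simp: inversions_def)
  qed
  then obtain w where w: "w \<in> index t" "fst w \<le> level s" "level s < fst w + int n"
    "s = cell P w (level s)" by (rule P.R_cases)
  then have sw: "fst s = P w (level s)" by (metis fst_cell)
  have meets: "meets n w m" using w s(1) by (auto simp: meets_def)
  \<comment> \<open>The tile through \<open>s\<close> may continue to level \<open>m\<close>, which
    shifts its coordinate by 1; the strict bounds on \<open>s\<close> absorb this because distinct
    tiles have distinct coordinates.\<close>
  have near: "zig n P w m = 2 * fst s + (m - level s) \<or>
    level s = m - 1 \<and> \<bar>zig n P w m - (2 * fst s + (m - level s))\<bar> = 1"
  proof (cases "level s = m")
    case True
    then show ?thesis using w sw by (simp add: zig_def)
  next
    case False
    then have lev: "level s = m - 1" using s(1) by simp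
    show ?thesis
    proof (cases "m < fst w + int n")
      case True
      then show ?thesis using P.step[OF w(1), of "m - 1"] w(2) lev sw by (auto simp: zig_def)
    next
      case False
      then show ?thesis using lev sw by (simp add: zig_def)
    qed
  qed
  show ?thesis
  proof (rule ccontr)
    assume "s \<notin> tile n P i \<union> tile n P j"
    then have "w \<noteq> i" "w \<noteq> j" using w sw by (auto simp: mem_tile_iff)
    then have "zig n P w m \<noteq> zig n P i m" "zig n P w m \<noteq> zig n P j m"
      using P.zig_inj idx w(1) meets ij(2,3) by blast+
    then have "zig n P i m < zig n P w m" "zig n P w m < zig n P j m"
      using near s(2,3) by linarith+
    then show False
      using none[of w] P.before_iff[OF idx(1) w(1) ij(2) meets] P.before_iff[OF w(1) idx(2) meets ij(3)]
      by simp
  qed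
qed

lemma minimal_inversion_consecutive:
  assumes ij: "(i, j) \<in> inversions"
    and none: "\<And>w. (i, w) \<in> before n t P \<Longrightarrow> (w, j) \<notin> before n t P"
    and q: "fst i \<le> q" "q < fst i + int n" "fst j \<le> q" "q < fst j + int n"
  shows "P j q = P i q + 1"
proof (rule ccontr)
  assume ne: "P j q \<noteq> P i q + 1"
  have idx: "i \<in> index t" "j \<in> index t" using ij inversions_subset by auto
  have less: "P i q < P j q"
    using P.before_iff_same_level[of i q j] ij idx q by (auto simp: inversions_def)
  \<comment> \<open>The next column on level \<open>q\<close> after the square of \<open>i\<close>;
    if \<open>j\<close> were farther right, this square would lie strictly between them.\<close>
  define s where "s = (P i q + 1, q - (P i q + 1))"
  have lev: "level s = q" "fst s = P i q + 1" by (simp_all add: s_def level_def)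
  have m: "meets n i q" "meets n j q" using q by (auto simp: meets_def)
  have "s \<in> tile n P i \<union> tile n P j"
    using ne less q lev by (intro zigzag_between[OF ij m none]) (auto simp: zig_def)
  then show False using ne lev by (auto simp: mem_tile_iff)
qed

text \<open>On common levels the columns are consecutive. The joining conditions come from the
  zigzags at the two ends of the common range, where a wrong step would leave a square between the
  tiles that belongs to neither.\<close>

lemma minimal_inversion_exchangeable:
  assumes ij: "(i, j) \<in> inversions"
    and none: "\<And>w. (i, w) \<in> before n t P \<Longrightarrow> (w, j) \<notin> before n t P"
  shows "exchangeable n R t P i j \<or> exchangeable n R t P j i"
proof -
  note con = minimal_inversion_consecutive[OF assms]
  note btw = zigzag_between[OF ij _ _ none]
  note lv = inversion_levels[OF ij]
  have idx: "i \<in> index t" "j \<in> index t" using ij inversions_subset by auto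
  have sq: "level (x, l - x) = l" "fst (x, l - x) = x" for x l :: int
    by (simp_all add: level_def)
  show ?thesis
  proof (cases "fst i < fst j")
    case True
    have "exchangeable n R t P i j"
    proof unfold_locales
      show "i \<in> index t" "j \<in> index t" "fst i < fst j" "fst j < fst i + int n"
        using idx True lv by auto
      show "\<bar>P i q - P j q\<bar> = 1" if "fst j \<le> q" "q < fst i + int n" for q
        using con[of q] that True by simp
      \<comment> \<open>The square directly below that of \<open>i\<close> lies between the tiles on
        the zigzag, and \<open>j\<close> has not started yet, so it belongs to
        \<open>i\<close>.\<close>
      have "P i (fst j - 1) = P i (fst j)"
      proof -
        have "(P i (fst j), fst j - 1 - P i (fst j)) \<in> tile n P i \<union> tile n P j"
          using con[of "fst j"] True lv by (intro btw[of "fst j"]) (auto simp: meets_def zig_def sq)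
        then show ?thesis by (auto simp: mem_tile_iff sq)
      qed
      then show "P j (fst j) = P i (fst j - 1) \<or> P j (fst j) = P i (fst j - 1) + 1"
        using con[of "fst j"] True lv by simp
      define m where "m = fst i + int n"
      have m: "fst i \<le> m - 1" "m - 1 < fst i + int n" "fst j \<le> m - 1" "m < fst j + int n"
        using True lv by (auto simp: m_def)
      have c: "P j (m - 1) = P i (m - 1) + 1" using con[of "m - 1"] m by simp
      \<comment> \<open>Here \<open>i\<close> has ended on level \<open>m - 1\<close>. If
        \<open>j\<close> stepped to the right, the square directly above its previous one would lie
        between the tiles.\<close>
      have "P j m \<noteq> P j (m - 1) + 1"
      proof
        assume up: "P j m = P j (m - 1) + 1"
        have "(P j (m - 1), m - P j (m - 1)) \<in> tile n P i \<union> tile n P j"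
          using c up m by (intro btw[of m]) (auto simp: meets_def zig_def sq m_def)
        then show False using up by (auto simp: mem_tile_iff sq m_def)
      qed
      then have "P j m = P i (m - 1) + 1" using P.step[OF idx(2), of "m - 1"] m c by auto
      then show "P j (fst i + int n) = P i (fst i + int n - 1) \<or>
          P j (fst i + int n) = P i (fst i + int n - 1) + 1"
        by (simp add: m_def)
    qed
    then show ?thesis ..
  next
    case False
    then have less: "fst j < fst i" using lv by simp
    have "exchangeable n R t P j i"
    proof unfold_locales
      show "i \<in> index t" "j \<in> index t" "fst j < fst i" "fst i < fst j + int n"
        using idx less lv by auto
      show "\<bar>P j q - P i q\<bar> = 1" if "fst i \<le> q" "q < fst j + int n" for q
        using con[of q] that less by simp
      have "P j (fst i - 1) = P i (fst i)"
      proof -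
        have "(P i (fst i), fst i - 1 - P i (fst i)) \<in> tile n P i \<union> tile n P j"
          using con[of "fst i"] less lv by (intro btw[of "fst i"]) (auto simp: meets_def zig_def sq)
        then show ?thesis by (auto simp: mem_tile_iff sq)
      qed
      then show "P i (fst i) = P j (fst i - 1) \<or> P i (fst i) = P j (fst i - 1) + 1" by simp
      define m where "m = fst j + int n"
      have m: "fst j \<le> m - 1" "m - 1 < fst j + int n" "fst i \<le> m - 1" "m < fst i + int n"
        using less lv by (auto simp: m_def)
      have c: "P j (m - 1) = P i (m - 1) + 1" using con[of "m - 1"] m by simp
      \<comment> \<open>Here \<open>j\<close> has ended on level \<open>m - 1\<close>. If
        \<open>i\<close> kept its column, the square directly above the last one of \<open>j\<close>
        would lie between the tiles.\<close>
      have "P i m \<noteq> P i (m - 1)"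
      proof
        assume stay: "P i m = P i (m - 1)"
        have "(P j (m - 1), m - P j (m - 1)) \<in> tile n P i \<union> tile n P j"
          using c stay m by (intro btw[of m]) (auto simp: meets_def zig_def sq m_def)
        then show False using stay c by (auto simp: mem_tile_iff sq m_def)
      qed
      then have "P i m = P j (m - 1)" using P.step[OF idx(1), of "m - 1"] m c by auto
      then show "P i (fst j + int n) = P j (fst j + int n - 1) \<or>
          P i (fst j + int n) = P j (fst j + int n - 1) + 1"
        by (simp add: m_def)
    qed
    then show ?thesis ..
  qed
qed

section \<open>Tilings without inversions\<close>

text \<open>Without inversions each tile has the same tiles to its left on level \<open>m\<close> in
  both tilings. Their number is the number of squares of \<open>R\<close> to its left, which would
  be larger at a column farther right, since the square at the old column then counts too.\<close>

lemma not_less_if_no_inversions: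
  assumes none: "inversions = {}" and i: "i \<in> index t" "fst i \<le> m" "m < fst i + int n"
  shows "\<not> P i m < Q i m"
proof
  assume less: "P i m < Q i m"
  define I where "I = {k \<in> index t. fst k \<le> m \<and> m < fst k + int n}"
  have same: "P k m < P i m \<longleftrightarrow> Q k m < Q i m" if k: "k \<in> I" for k
  proof (cases "k = i")
    case False
    have k': "k \<in> index t" "fst k \<le> m" "m < fst k + int n" using k by (auto simp: I_def)
    then have "\<bar>fst k - fst i\<bar> \<le> int n" "\<bar>fst i - fst k\<bar> \<le> int n" using i by auto
    then have "(k, i) \<in> before n t P \<longleftrightarrow> (k, i) \<in> before n t Q"
      using P.before_total[of k i] Q.before_total[of k i] P.before_asym Q.before_asym
        k'(1) i(1) False none unfolding inversions_def by blast
    then show ?thesis using P.before_iff_same_level Q.before_iff_same_level k' i by simp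
  qed simp
  have count: "card {s \<in> R. level s = m \<and> fst s < P' i m} = card {k \<in> I. P' k m < P' i m}"
    if "labelled n R t P'" for P'
  proof -
    interpret P': labelled n R t P' by fact
    have "{s \<in> R. level s = m \<and> fst s < P' i m} = (\<lambda>k. cell P' k m) ` {k \<in> I. P' k m < P' i m}"
    proof (intro set_eqI iffI)
      fix s assume s: "s \<in> {s \<in> R. level s = m \<and> fst s < P' i m}"
      then have "s \<in> R" by simp
      then obtain k where "k \<in> index t" "fst k \<le> level s" "level s < fst k + int n"
        "s = cell P' k (level s)" by (rule P'.R_cases)
      then show "s \<in> (\<lambda>k. cell P' k m) ` {k \<in> I. P' k m < P' i m}"
        using s by (auto simp: I_def eq_cell_iff intro!: image_eqI[of s _ k])
    next
      fix s assume "s \<in> (\<lambda>k. cell P' k m) ` {k \<in> I. P' k m < P' i m}"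
      then show "s \<in> {s \<in> R. level s = m \<and> fst s < P' i m}"
        by (auto simp: I_def P'.cell_in_R)
    qed
    moreover have "inj_on (\<lambda>k. cell P' k m) {k \<in> I. P' k m < P' i m}"
      using P'.inj by (auto simp: inj_on_def I_def eq_cell_iff)
    ultimately show ?thesis by (simp add: card_image)
  qed
  have "{s \<in> R. level s = m \<and> fst s < P i m} \<subset> {s \<in> R. level s = m \<and> fst s < Q i m}"
  proof -
    have "cell P i m \<in> R" using P.cell_in_R i by simp
    then have "cell P i m \<in> {s \<in> R. level s = m \<and> fst s < Q i m}"
      "cell P i m \<notin> {s \<in> R. level s = m \<and> fst s < P i m}" using less by auto
    moreover have "{s \<in> R. level s = m \<and> fst s < P i m} \<subseteq> {s \<in> R. level s = m \<and> fst s < Q i m}"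
      using less by auto
    ultimately show ?thesis by blast
  qed
  then have "card {s \<in> R. level s = m \<and> fst s < P i m} < card {s \<in> R. level s = m \<and> fst s < Q i m}"
    using P.finite_R by (intro psubset_card_mono) auto
  moreover have "{k \<in> I. P k m < P i m} = {k \<in> I. Q k m < Q i m}" using same by auto
  ultimately show False using count[OF P.labelled_axioms] count[OF Q.labelled_axioms] by simp
qed

lemma tiles_eq_if_no_inversions:
  assumes "inversions = {}"
  shows "tiles n t P = tiles n t Q"
proof -
  interpret swap: labelled_pair n R t Q P using labelled_pair_swap labelled_pair_axioms .
  have "swap.inversions = {}" using assms by (auto simp: inversions_def swap.inversions_def)
  then have eq: "P i m = Q i m" if "i \<in> index t" "fst i \<le> m" "m < fst i + int n" for i m
    using not_less_if_no_inversions[OF assms that] swap.not_less_if_no_inversions[OF _ that] by auto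
  have "tile n P i = tile n Q i" if "i \<in> index t" for i
  proof (rule set_eqI)
    show "s \<in> tile n P i \<longleftrightarrow> s \<in> tile n Q i" for s
      using eq[OF that, of "level s"] by (auto simp: mem_tile_iff)
  qed
  then show ?thesis unfolding tiles_def by (intro image_cong) simp_all
qed

end

section \<open>Removing inversions one at a time\<close>

definition tiling_move :: "nat \<Rightarrow> square set \<Rightarrow> square set set \<Rightarrow> square set set \<Rightarrow> bool" where
  "tiling_move n R \<alpha> \<beta> \<longleftrightarrow> ribbon_tiling n R \<alpha> \<and> ribbon_tiling n R \<beta> \<and> local_move n \<alpha> \<beta>"

text \<open>Induction on the number of inversions: \<open>Q\<close> stays fixed while a minimal
  inversion is exchanged in \<open>P\<close>.\<close>

lemma labelled_pair_connected:
  assumes "labelled_pair n R t P Q"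
  shows "(tiling_move n R)\<^sup>*\<^sup>* (tiles n t P) (tiles n t Q)"
  using assms
proof (induction "card (labelled_pair.inversions n t P Q)" arbitrary: P rule: less_induct)
  case less
  interpret PQ: labelled_pair n R t P Q by (fact less.prems)
  show ?case
  proof (cases "PQ.inversions = {}")
    case True
    then show ?thesis using PQ.tiles_eq_if_no_inversions by simp
  next
    case False
    then obtain i j where ij: "(i, j) \<in> PQ.inversions"
      and none: "\<And>w. (i, w) \<in> before n t P \<Longrightarrow> (w, j) \<notin> before n t P"
      using PQ.minimal_inversion by blast
    obtain a b where exch: "exchangeable n R t P a b" "{a, b} = {i, j}"
      using PQ.minimal_inversion_exchangeable[OF ij none] by blast
    interpret exchangeable n R t P a b by (fact exch(1))
    interpret P': labelled n R t P' by (rule labelled_exchange)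
    interpret P'Q: labelled_pair n R t P' Q
      by unfold_locales (fact PQ.simply)
    have "P'Q.inversions \<subset> PQ.inversions"
    proof
      show "P'Q.inversions \<subseteq> PQ.inversions"
      proof
        fix x assume x: "x \<in> P'Q.inversions"
        obtain k w where [simp]: "x = (k, w)" by (cases x)
        have kw: "(k, w) \<in> before n t P'" "(w, k) \<in> before n t Q"
          using x by (auto simp: P'Q.inversions_def)
        show "x \<in> PQ.inversions"
        proof (cases "{k, w} = {a, b}")
          case False
          \<comment> \<open>\<open>before_exchange\<close> asks for start levels less than
            \<open>n\<close> apart; the pair has this as an inversion between \<open>P'\<close> and
            \<open>Q\<close>.\<close>
          then show ?thesis
            using before_exchange[of k w] P'Q.inversion_levels[of k w] x kw
            by (auto simp: PQ.inversions_def)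
        next
          case True
          \<comment> \<open>The exchanged pair now has the order that it has in \<open>Q\<close>, so
            it cannot be an inversion.\<close>
          then have "(w, k) \<in> before n t P"
            using before_exchange_ab kw(1) by (auto simp: doubleton_eq_iff)
          then have "(w, k) \<in> PQ.inversions \<or> (k, w) \<in> PQ.inversions"
            using ij True exch(2) by (metis doubleton_eq_iff)
          then have "(k, w) \<in> before n t Q"
            using \<open>(w, k) \<in> before n t P\<close> PQ.P.before_asym by (auto simp: PQ.inversions_def)
          then show ?thesis using kw(2) PQ.Q.before_asym by blast
        qed
      qed
      have "(i, j) \<in> before n t P" using ij by (simp add: PQ.inversions_def)
      then have "(i, j) \<notin> before n t P'"
        using before_exchange_ab exch(2) PQ.P.before_asym[of i j] by (auto simp: doubleton_eq_iff)
      then show "P'Q.inversions \<noteq> PQ.inversions"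
        using ij by (auto simp: P'Q.inversions_def)
    qed
    moreover have "finite PQ.inversions"
      using finite_subset[OF PQ.inversions_subset] PQ.P.finite_index by simp
    ultimately have "card P'Q.inversions < card PQ.inversions" by (rule psubset_card_mono[rotated])
    then have "(tiling_move n R)\<^sup>*\<^sup>* (tiles n t P') (tiles n t Q)"
      using less.hyps P'Q.labelled_pair_axioms by blast
    moreover have "tiling_move n R (tiles n t P) (tiles n t P')"
      unfolding tiling_move_def
      using PQ.P.ribbon_tiling_tiles P'.ribbon_tiling_tiles local_move_exchange by blast
    ultimately show ?thesis by (rule converse_rtranclp_into_rtranclp[rotated])
  qed
qed

theorem theorem1p1:
  fixes n :: nat and R :: "square set" and \<alpha> \<beta> :: "square set set"
  assumes "n > 0"
    and "simply_connected_region R"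
    and "ribbon_tiling n R \<alpha>"
    and "ribbon_tiling n R \<beta>"
  shows "\<exists>(m::nat) (\<gamma> :: nat \<Rightarrow> square set set).
           \<gamma> 0 = \<alpha> \<and> \<gamma> m = \<beta> \<and>
           (\<forall>r\<le>m. ribbon_tiling n R (\<gamma> r)) \<and>
           (\<forall>r<m. local_move n (\<gamma> r) (\<gamma> (Suc r)))"
proof -
  have fin: "finite R" using assms(2) by (simp add: simply_connected_region_def region_def)
  obtain t P where P: "labelled n R t P" "tiles n t P = \<alpha>"
    using ribbon_tiling_labelled[OF assms(1) fin assms(3)] by blast
  obtain t' Q where Q: "labelled n R t' Q" "tiles n t' Q = \<beta>"
    using ribbon_tiling_labelled[OF assms(1) fin assms(4)] by blast
  have "t' = t" using labelled_counts_unique[OF Q(1) P(1)] .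
  then have "labelled_pair n R t P Q"
    using P Q assms(2) by (simp add: labelled_pair_def labelled_pair_axioms_def)
  then have "(tiling_move n R)\<^sup>*\<^sup>* \<alpha> \<beta>"
    using labelled_pair_connected P Q \<open>t' = t\<close> by blast
  then obtain m where "(tiling_move n R ^^ m) \<alpha> \<beta>" using rtranclp_imp_relpowp by metis
  then obtain \<gamma> where \<gamma>: "\<gamma> 0 = \<alpha>" "\<gamma> m = \<beta>" "\<And>r. r < m \<Longrightarrow> tiling_move n R (\<gamma> r) (\<gamma> (Suc r))"
    unfolding relpowp_fun_conv by blast
  moreover have "ribbon_tiling n R (\<gamma> r)" if "r \<le> m" for r
    using \<gamma> that assms(4) by (cases "r = m") (auto simp: tiling_move_def)
  ultimately show ?thesis
    by (intro exI[of _ m] exI[of _ \<gamma>]) (auto simp: tiling_move_def)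
qed

end
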